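(* Let $A\in\mathbb{R}^{p\times m}$, $B\in\mathbb{R}^{n\times q}$, $C\in\mathbb{R}^{p\times q}$ be such that $AXB=C$ is consistent, let $G\in\mathbb{R}^{m\times m}$ be symmetric positive definite, and let $(X^k)_{k\ge 0}$ be the random sequence generated by the sketch-and-project iteration $X^{k+1}=X^k-Z_1'(X^k-X^* )Z_2$ from an arbitrary (deterministic) $X^0\in\mathbb{R}^{m\times n}$. Then for every $X^*\in\mathbb{R}^{m\times n}$ satisfying $AX^*B=C$ and every $k\ge 0$, $$\mathbf{E}\left[\|X^k-X^*\|_{F(G)}^2\right]\le \rho^k\,\|X^0-X^*\|_{F(G)}^2,\qquad \rho=1-\lambda_{\min}\left(\mathbf{E}[Z_2\otimes Z_1']\right).$$ Therefore, the sequence $(X^k)$ converges to $X^*$ (in mean square, i.e. $\mathbf{E}[\|X^k-X^*\|_{F(G)}^2]\to 0$) if $0\le\rho<1$.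
   Context: At each iteration, random matrices $S\in\mathbb{R}^{p\times\tau_1}$ and $P\in\mathbb{R}^{q\times\tau_2}$ (whose numbers of columns $\tau_1,\tau_2$ may be random) are drawn from a fixed distribution, independently of the previous iterations (i.i.d. across iterations). With $\dagger$ the Moore-Penrose pseudoinverse, $$Z_1'=G^{-1}A^\top S\,(S^\top AG^{-1}A^\top S)^\dagger S^\top A\in\mathbb{R}^{m\times m},\qquad Z_2=BP\,(P^\top B^\top BP)^\dagger P^\top B^\top\in\mathbb{R}^{n\times n},$$ using the $S,P$ drawn at that iteration. The iteration is $$X^{k+1}=X^k-G^{-1}A^\top S(S^\top AG^{-1}A^\top S)^\dagger S^\top(AX^kB-C)P(P^\top B^\top BP)^\dagger P^\top B^\top,$$ which equals $X^k-Z_1'(X^k-X^* )Z_2$ for any solution $X^*$ of $AX^*B=C$. The norm is $\|X\|_{F(G)}^2=\mathrm{Tr}(X^\top GX)$; $\otimes$ is the Kronecker product; $\lambda_{\min}$ is the smallest eigenvalue ($\mathbf{E}[Z_2\otimes Z_1']$ is similar to a symmetric matrix via conjugation by $I\otimes G^{1/2}$, so its eigenvalues are real). *)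

theory Defs
  imports
    "HOL-Probability.Probability"
    "Jordan_Normal_Form.Spectral_Radius"
    "Jordan_Normal_Form.Gauss_Jordan_Elimination"
begin

definition mat_trace :: "real mat \<Rightarrow> real" where
  "mat_trace A = (\<Sum>i<dim_row A. A $$ (i, i))"

definition symmetric_pos_def :: "nat \<Rightarrow> real mat \<Rightarrow> bool" where
  "symmetric_pos_def m G \<longleftrightarrow>
     G \<in> carrier_mat m m \<and> transpose_mat G = G \<and>
     (\<forall>v \<in> carrier_vec m. v \<noteq> 0\<^sub>v m \<longrightarrow> 0 < scalar_prod v (G *\<^sub>v v))"

text \<open>Only used for invertible matrices, on which \<open>mat_inverse\<close> returns \<open>Some\<close> inverse.\<close>
definition inv_mat :: "real mat \<Rightarrow> real mat" where
  "inv_mat G = the (mat_inverse G)"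

text \<open>The Moore-Penrose pseudoinverse is the unique matrix satisfying the four Penrose equations.
  The zero matrix of any shape, including an empty one, also has one.\<close>
definition penrose :: "real mat \<Rightarrow> real mat \<Rightarrow> bool" where
  "penrose A Y \<longleftrightarrow>
     Y \<in> carrier_mat (dim_col A) (dim_row A) \<and>
     A * Y * A = A \<and> Y * A * Y = Y \<and>
     transpose_mat (A * Y) = A * Y \<and> transpose_mat (Y * A) = Y * A"

definition pinv :: "real mat \<Rightarrow> real mat" where
  "pinv A = (THE Y. penrose A Y)"

definition kronecker :: "real mat \<Rightarrow> real mat \<Rightarrow> real mat" where
  "kronecker A B =
     Matrix.mat (dim_row A * dim_row B) (dim_col A * dim_col B)
       (\<lambda>(i, j). A $$ (i div dim_row B, j div dim_col B) * B $$ (i mod dim_row B, j mod dim_col B))"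

text \<open>For square matrices of positive size all of whose complex eigenvalues are real, so that the
  real spectrum is finite, nonempty and contains all eigenvalues.\<close>
definition lambda_min :: "real mat \<Rightarrow> real" where
  "lambda_min A = Min (spectrum A)"

text \<open>The squared weighted Frobenius norm of \<open>X\<close> with weight \<open>G\<close>.\<close>
definition frob_norm_sq :: "real mat \<Rightarrow> real mat \<Rightarrow> real" where
  "frob_norm_sq G X = mat_trace (transpose_mat X * G * X)"

text \<open>Real matrices with \<open>r\<close> rows and an arbitrary number of columns, as the disjoint union over
  \<open>c\<close> of the spaces of \<open>r\<close> by \<open>c\<close> matrices, each with its Borel sigma-algebra: the first family of
  generators makes the number of columns measurable, the second one the entries.\<close>
definition mat_algebra :: "nat \<Rightarrow> real mat measure" where
  "mat_algebra r = sigma {Q. dim_row Q = r}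
     ({carrier_mat r c | c. True} \<union>
      {{Q \<in> carrier_mat r c. Q $$ (i, j) \<in> U} | c i j U. i < r \<and> j < c \<and> open U})"

text \<open>Entrywise expectation of an \<open>r\<close> by \<open>c\<close> matrix-valued function.\<close>
definition mat_expectation :: "nat \<Rightarrow> nat \<Rightarrow> 'a measure \<Rightarrow> ('a \<Rightarrow> real mat) \<Rightarrow> real mat" where
  "mat_expectation r c D F = Matrix.mat r c (\<lambda>(i, j). \<integral>x. F x $$ (i, j) \<partial>D)"

definition Z1' :: "real mat \<Rightarrow> real mat \<Rightarrow> real mat \<Rightarrow> real mat" where
  "Z1' G A S =
     inv_mat G * transpose_mat A * S *
     pinv (transpose_mat S * A * inv_mat G * transpose_mat A * S) *
     transpose_mat S * A"

definition Z2 :: "real mat \<Rightarrow> real mat \<Rightarrow> real mat" where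
  "Z2 B P =
     B * P * pinv (transpose_mat P * transpose_mat B * B * P) * transpose_mat P * transpose_mat B"

definition sketch_project_step ::
  "real mat \<Rightarrow> real mat \<Rightarrow> real mat \<Rightarrow> real mat \<Rightarrow> real mat \<Rightarrow> real mat \<Rightarrow> real mat \<Rightarrow> real mat" where
  "sketch_project_step G A B C S P X =
     X - inv_mat G * transpose_mat A * S *
         pinv (transpose_mat S * A * inv_mat G * transpose_mat A * S) *
         transpose_mat S * (A * X * B - C) * P *
         pinv (transpose_mat P * transpose_mat B * B * P) * transpose_mat P * transpose_mat B"

primrec sketch_project ::
  "real mat \<Rightarrow> real mat \<Rightarrow> real mat \<Rightarrow> real mat \<Rightarrow> real mat \<Rightarrow>
   (nat \<Rightarrow> real mat) \<Rightarrow> (nat \<Rightarrow> real mat) \<Rightarrow> nat \<Rightarrow> real mat" where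
  "sketch_project G A B C X0 S P 0 = X0"
| "sketch_project G A B C X0 S P (Suc k) =
     sketch_project_step G A B C (S k) (P k) (sketch_project G A B C X0 S P k)"

end

theory Submission
  imports Defs
begin

text \<open>
  Stack the columns of the error \<open>X - X*\<close> into a vector \<open>v\<close>. One iteration becomes
  \<open>v \<mapsto> v - K v\<close> with \<open>K = Z2 \<otimes> Z1'\<close>, which is idempotent and self-adjoint for the
  inner product \<open>H = I \<otimes> G\<close>, so that the energy \<open>v . H v\<close> drops by exactly
  \<open>v . H K v\<close>. Since the fresh sketch is independent of the current error, the expected drop is
  the expectation of \<open>v . H E[K] v\<close>, and this is at least \<open>lambda_min E[K]\<close> times the expected
  energy because the minimum of the generalized Rayleigh quotient of an \<open>H\<close>-self-adjoint
  matrix is one of its eigenvalues.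

  Measurability of the pseudoinverse and its existence both come from a formula: if \<open>d x^k\<close> is the
  lowest nonzero term of the characteristic polynomial of a symmetric \<open>A\<close> and \<open>B\<close> the
  \<open>x^k\<close>-coefficient of the adjugate of \<open>x I - A\<close>, then \<open>N = - B / d\<close> commutes with \<open>A\<close>
  and \<open>A^2 N = A\<close>, whence the pseudoinverse of \<open>A\<close> is \<open>N A N\<close>.
\<close>

unbundle no vec_syntax
unbundle no inner_syntax

section \<open>Pseudoinverse of a symmetric matrix\<close>

text \<open>The weight \<open>G\<close> is never split into square roots: self-adjointness of
  \<open>K\<close> is expressed as symmetry of \<open>H * K\<close>, a condition that is linear in
  \<open>K\<close> and therefore survives taking expectations. Expectations can be split only once
  integrability is known, and the sketches themselves may be unbounded. The way out is that
  \<open>H * K\<close> lies between 0 and \<open>H\<close> in the order of quadratic forms; with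
  coercivity of \<open>H\<close> this bounds all entries of \<open>K\<close> and of the iterates by
  constants. The upper half of the same bound gives \<open>lambda_min\<close> at most 1 for the mean
  of \<open>K\<close>, so the contraction factor is nonnegative and one-step estimates can be
  chained.

  The pseudoinverse jumps where the rank drops, so its measurability cannot come from continuity.
  The matrix space is cut into countably many pieces instead, first by the number of columns of the
  sketch and then by the multiplicity of the eigenvalue 0 of its Gram matrix; on each piece the
  entries are rational functions of the data.\<close>

lemma mult_mat_assoc_dim:
  fixes A B C :: "'a :: semiring_0 mat"
  shows "dim_col A = dim_row B \<Longrightarrow> dim_col B = dim_row C \<Longrightarrow> A * B * C = A * (B * C)"
  by (rule assoc_mult_mat[of _ "dim_row A" "dim_col A" _ "dim_col B" _ "dim_col C"]) auto

text \<open>As in the associativity rule above, the premises are equations between dimensions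
  instead of carrier facts, so that simp can rewrite long products without guessing the inner
  dimensions.\<close>

lemma transpose_mult_dim:
  fixes A B :: "'a :: comm_semiring_0 mat"
  shows "dim_col A = dim_row B \<Longrightarrow> transpose_mat (A * B) = transpose_mat B * transpose_mat A"
  by (rule transpose_mult[of _ "dim_row A" "dim_col A" _ "dim_col B"]) auto

text \<open>\<open>A * Y\<close> and \<open>A * Z\<close> are both the orthogonal projection onto
  the column space of \<open>A\<close>, hence equal; likewise \<open>Y * A\<close> and
  \<open>Z * A\<close>. Then \<open>Y = Y * A * Y\<close> turns into \<open>Z * A * Z = Z\<close> by
  exchanging one factor at a time.\<close>

lemma penrose_unique:
  assumes "penrose A Y" "penrose A Z"
  shows "Y = Z"
proof -
  have [simp]: "dim_row Y = dim_col A" "dim_col Y = dim_row A"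
    "dim_row Z = dim_col A" "dim_col Z = dim_row A"
    using assms by (auto simp: penrose_def)
  have Y: "A * Y * A = A" "Y * A * Y = Y" "transpose_mat (A * Y) = A * Y" "transpose_mat (Y * A) = Y * A"
    and Z: "A * Z * A = A" "Z * A * Z = Z" "transpose_mat (A * Z) = A * Z" "transpose_mat (Z * A) = Z * A"
    using assms by (auto simp: penrose_def)
  have AY: "A * Y = A * Z"
  proof -
    have "A * Y = transpose_mat (A * Z * A * Y)"
      using Z(1) Y(3) by simp
    also have "\<dots> = transpose_mat ((A * Z) * (A * Y))"
      by (simp add: mult_mat_assoc_dim)
    also have "\<dots> = (A * Y) * (A * Z)"
      using Y(3) Z(3) by (subst transpose_mult_dim) simp_all
    also have "\<dots> = (A * Y * A) * Z" by (simp add: mult_mat_assoc_dim)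
    finally show ?thesis using Y(1) by simp
  qed
  have YA: "Y * A = Z * A"
  proof -
    have "Y * A = transpose_mat (Y * (A * Z * A))"
      using Z(1) Y(4) by simp
    also have "\<dots> = transpose_mat ((Y * A) * (Z * A))"
      by (simp add: mult_mat_assoc_dim)
    also have "\<dots> = (Z * A) * (Y * A)"
      using Y(4) Z(4) by (subst transpose_mult_dim) simp_all
    also have "\<dots> = Z * (A * Y * A)" by (simp add: mult_mat_assoc_dim)
    finally show ?thesis using Y(1) by simp
  qed
  have "Y = Y * A * Y" using Y(2) by simp
  also have "\<dots> = Z * A * Y" using YA by simp
  also have "\<dots> = Z * (A * Y)" by (simp add: mult_mat_assoc_dim)
  also have "\<dots> = Z * A * Z" using AY by (simp add: mult_mat_assoc_dim)
  finally show ?thesis using Z(2) by simp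
qed

lemma pinv_eqI: "penrose A Y \<Longrightarrow> pinv A = Y"
  unfolding pinv_def by (rule the_equality) (auto intro: penrose_unique)

lemma scalar_prod_self_eq_0:
  fixes v :: "real Matrix.vec"
  shows "scalar_prod v v = 0 \<longleftrightarrow> v = 0\<^sub>v (dim_vec v)"
proof
  assume "scalar_prod v v = 0"
  then have "(\<Sum>i<dim_vec v. v $ i * v $ i) = 0"
    by (simp add: scalar_prod_def atLeast0LessThan)
  then have "\<forall>i\<in>{..<dim_vec v}. v $ i * v $ i = 0"
    by (subst (asm) sum_nonneg_eq_0_iff) auto
  then show "v = 0\<^sub>v (dim_vec v)" by (intro eq_vecI) auto
next
  assume *: "v = 0\<^sub>v (dim_vec v)"
  show "scalar_prod v v = 0"
    by (subst *) (simp add: scalar_prod_def)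
qed

text \<open>The diagonal of the Gram matrix holds the squared lengths of the columns.\<close>

lemma gram_eq_0:
  fixes A :: "real mat"
  assumes A: "A \<in> carrier_mat r c" and "transpose_mat A * A = 0\<^sub>m c c"
  shows "A = 0\<^sub>m r c"
proof (rule eq_matI)
  fix i j assume ij: "i < dim_row (0\<^sub>m r c :: real mat)" "j < dim_col (0\<^sub>m r c :: real mat)"
  have "scalar_prod (col A j) (col A j) = (transpose_mat A * A) $$ (j, j)"
    using ij A by simp
  also have "\<dots> = 0" using ij by (simp add: assms)
  finally have "col A j = 0\<^sub>v (dim_vec (col A j))"
    by (simp add: scalar_prod_self_eq_0)
  then have "col A j $ i = 0\<^sub>v r $ i" using A by simp
  then show "A $$ (i, j) = 0\<^sub>m r c $$ (i, j)" using A ij by simp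
qed (use A in auto)

text \<open>The Gram matrix of \<open>A * B\<close> contains the factor \<open>A * (A * B)\<close>.
  In other words 0 is a semisimple eigenvalue of a symmetric matrix, which is what the construction
  of \<open>group_inv\<close> needs.\<close>

lemma symmetric_square_mult_eq_0:
  fixes A :: "real mat"
  assumes A: "A \<in> carrier_mat n n" "transpose_mat A = A"
    and B: "B \<in> carrier_mat n c" and 0: "A * (A * B) = 0\<^sub>m n c"
  shows "A * B = 0\<^sub>m n c"
proof (rule gram_eq_0)
  have "transpose_mat (A * B) * (A * B) = transpose_mat B * (A * (A * B))"
    using A B by (simp add: transpose_mult_dim mult_mat_assoc_dim)
  then show "transpose_mat (A * B) * (A * B) = 0\<^sub>m c c" using 0 B by simp
qed (use A B in auto)

section \<open>Adjugate coefficients and a partial inverse of a symmetric matrix\<close>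

definition adj_coeff :: "nat \<Rightarrow> real mat \<Rightarrow> real mat" where
  "adj_coeff k A = map_mat (\<lambda>p. coeff p k) (adj_mat (char_poly_matrix A))"

text \<open>The multiplicity of 0 as a root of the characteristic polynomial.\<close>

definition char_order :: "real mat \<Rightarrow> nat" where
  "char_order A = (LEAST k. coeff (char_poly A) k \<noteq> 0)"

text \<open>For symmetric \<open>A\<close> this inverts \<open>A\<close> on its range. On the kernel
  it need not vanish: if the characteristic polynomial is \<open>x^k * r\<close> with
  \<open>r(0)\<close> nonzero, it acts there as the scalar \<open>- r'(0) / r(0)\<close>. This is
  why the pseudoinverse is obtained only after multiplying it by \<open>A\<close> and by itself once
  more.\<close>

definition group_inv :: "real mat \<Rightarrow> real mat" where
  "group_inv A = (- 1 / coeff (char_poly A) (char_order A)) \<cdot>\<^sub>m adj_coeff (char_order A) A"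

lemma adj_coeff_carrier:
  "A \<in> carrier_mat n n \<Longrightarrow> adj_coeff k A \<in> carrier_mat n n"
  using adj_mat(1)[OF char_poly_matrix_closed] by (auto simp: adj_coeff_def)

text \<open>Multiplication by \<open>x\<close> shifts coefficients by one, so the
  \<open>x\<close>-part of \<open>x I - A\<close> contributes the preceding coefficient of
  \<open>B\<close>; at \<open>k = 0\<close> there is none and the zero matrix takes its
  place.\<close>

lemma coeff_char_poly_matrix_mult:
  assumes A: "A \<in> carrier_mat n n" and B: "B \<in> carrier_mat n n"
  shows "map_mat (\<lambda>p. coeff p k) (char_poly_matrix A * B) =
     (case k of 0 \<Rightarrow> 0\<^sub>m n n | Suc j \<Rightarrow> map_mat (\<lambda>p. coeff p j) B) - A * map_mat (\<lambda>p. coeff p k) B"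
    (is ?left)
    and "map_mat (\<lambda>p. coeff p k) (B * char_poly_matrix A) =
     (case k of 0 \<Rightarrow> 0\<^sub>m n n | Suc j \<Rightarrow> map_mat (\<lambda>p. coeff p j) B) - map_mat (\<lambda>p. coeff p k) B * A"
    (is ?right)
proof -
  have entry: "char_poly_matrix A $$ (i, j) = (if i = j then [:0, 1:] else 0) - [:A $$ (i, j):]"
    if "i < n" "j < n" for i j
    using that A by (auto simp: char_poly_matrix_def)
  have X: "coeff ([:0, 1:] * p) k = (case k of 0 \<Rightarrow> 0 | Suc j \<Rightarrow> coeff p j)" for p :: "real poly"
    by (cases k) auto
  show ?left
  proof (rule eq_matI, goal_cases)
    case (1 i j)
    then have ij: "i < n" "j < n" using A B by (auto split: nat.splits)
    have "(char_poly_matrix A * B) $$ (i, j) = (\<Sum>l<n. char_poly_matrix A $$ (i, l) * B $$ (l, j))"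
      using ij B carrier_matD[OF char_poly_matrix_closed[OF A]]
      by (simp add: scalar_prod_def atLeast0LessThan)
    also have "\<dots> = (\<Sum>l<n. if l = i then [:0,1:] * B $$ (l, j) else 0) -
        (\<Sum>l<n. [:A $$ (i, l):] * B $$ (l, j))"
      unfolding sum_subtractf[symmetric]
      by (rule sum.cong) (use ij in \<open>auto simp: entry algebra_simps\<close>)
    also have "\<dots> = [:0,1:] * B $$ (i, j) - (\<Sum>l<n. [:A $$ (i, l):] * B $$ (l, j))"
      using ij by simp
    finally have "coeff ((char_poly_matrix A * B) $$ (i, j)) k =
      coeff ([:0,1:] * B $$ (i, j)) k - (\<Sum>l<n. A $$ (i, l) * coeff (B $$ (l, j)) k)"
      by (simp add: coeff_sum)
    moreover have "A * map_mat (\<lambda>p. coeff p k) B = Matrix.mat n n (\<lambda>(i, j). \<Sum>l<n. A $$ (i, l) * coeff (B $$ (l, j)) k)"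
      using A B by (auto simp: scalar_prod_def atLeast0LessThan)
    ultimately show ?case unfolding X using ij A B carrier_matD[OF char_poly_matrix_closed[OF A]]
      by (simp add: scalar_prod_def atLeast0LessThan del: index_mult_mat(1) split: nat.splits)
  qed (use A B carrier_matD[OF char_poly_matrix_closed[OF A]] in \<open>auto split: nat.splits\<close>)
  show ?right
  proof (rule eq_matI, goal_cases)
    case (1 i j)
    then have ij: "i < n" "j < n" using A B by (auto split: nat.splits)
    have "(B * char_poly_matrix A) $$ (i, j) = (\<Sum>l<n. B $$ (i, l) * char_poly_matrix A $$ (l, j))"
      using ij B carrier_matD[OF char_poly_matrix_closed[OF A]]
      by (simp add: scalar_prod_def atLeast0LessThan)
    also have "\<dots> = (\<Sum>l<n. if l = j then [:0,1:] * B $$ (i, l) else 0) -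
        (\<Sum>l<n. [:A $$ (l, j):] * B $$ (i, l))"
      unfolding sum_subtractf[symmetric]
      by (rule sum.cong) (use ij in \<open>auto simp: entry algebra_simps\<close>)
    also have "\<dots> = [:0,1:] * B $$ (i, j) - (\<Sum>l<n. [:A $$ (l, j):] * B $$ (i, l))"
      using ij by simp
    finally have "coeff ((B * char_poly_matrix A) $$ (i, j)) k =
      coeff ([:0,1:] * B $$ (i, j)) k - (\<Sum>l<n. A $$ (l, j) * coeff (B $$ (i, l)) k)"
      by (simp add: coeff_sum)
    moreover have "map_mat (\<lambda>p. coeff p k) B * A = Matrix.mat n n (\<lambda>(i, j). \<Sum>l<n. A $$ (l, j) * coeff (B $$ (i, l)) k)"
      using A B by (auto simp: scalar_prod_def atLeast0LessThan mult.commute)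
    ultimately show ?case unfolding X using ij A B carrier_matD[OF char_poly_matrix_closed[OF A]]
      by (simp add: scalar_prod_def atLeast0LessThan del: index_mult_mat(1) mult.commute split: nat.splits)
  qed (use A B carrier_matD[OF char_poly_matrix_closed[OF A]] in \<open>auto split: nat.splits\<close>)
qed

text \<open>Coefficient comparison in the two identities between a matrix, its adjugate and its
  determinant, applied to \<open>x I - A\<close>: the Faddeev-LeVerrier recursion. Having it on both
  sides makes each coefficient commute with \<open>A\<close>.\<close>

lemma adj_coeff_rec:
  assumes A: "A \<in> carrier_mat n n"
  defines "prev \<equiv> \<lambda>k. case k of 0 \<Rightarrow> 0\<^sub>m n n | Suc j \<Rightarrow> adj_coeff j A"
  shows "A * adj_coeff k A = prev k - coeff (char_poly A) k \<cdot>\<^sub>m 1\<^sub>m n"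
    and "adj_coeff k A * A = prev k - coeff (char_poly A) k \<cdot>\<^sub>m 1\<^sub>m n"
proof -
  let ?C = "char_poly_matrix A"
  have adj: "adj_mat ?C \<in> carrier_mat n n" using adj_mat(1)[OF char_poly_matrix_closed[OF A]] .
  have c: "map_mat (\<lambda>p. coeff p k) (char_poly A \<cdot>\<^sub>m 1\<^sub>m n) = coeff (char_poly A) k \<cdot>\<^sub>m 1\<^sub>m n"
    by (rule eq_matI) auto
  have P: "prev k = (case k of 0 \<Rightarrow> 0\<^sub>m n n | Suc j \<Rightarrow> adj_coeff j A)" for k
    by (simp add: prev_def)
  have [simp]: "prev k \<in> carrier_mat n n"
    using adj_coeff_carrier[OF A] by (auto simp: prev_def split: nat.splits)
  have eq_from: "Y = P - Z" if "Z = P - Y" "P \<in> carrier_mat n n" "Y \<in> carrier_mat n n"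
    for P Y Z :: "real mat"
    using that by (intro eq_matI) auto
  have "coeff (char_poly A) k \<cdot>\<^sub>m 1\<^sub>m n = prev k - A * adj_coeff k A"
    using coeff_char_poly_matrix_mult(1)[OF A adj, of k] adj_mat(2)[OF char_poly_matrix_closed[OF A]] c
    by (cases k) (simp_all add: char_poly_def[symmetric] adj_coeff_def[symmetric] P del: index_mult_mat)
  then show "A * adj_coeff k A = prev k - coeff (char_poly A) k \<cdot>\<^sub>m 1\<^sub>m n"
    by (rule eq_from) (use A adj_coeff_carrier[OF A] in \<open>auto intro!: mult_carrier_mat\<close>)
  have "coeff (char_poly A) k \<cdot>\<^sub>m 1\<^sub>m n = prev k - adj_coeff k A * A"
    using coeff_char_poly_matrix_mult(2)[OF A adj, of k] adj_mat(3)[OF char_poly_matrix_closed[OF A]] c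
    by (cases k) (simp_all add: char_poly_def[symmetric] adj_coeff_def[symmetric] P del: index_mult_mat)
  then show "adj_coeff k A * A = prev k - coeff (char_poly A) k \<cdot>\<^sub>m 1\<^sub>m n"
    by (rule eq_from) (use A adj_coeff_carrier[OF A] in \<open>auto intro!: mult_carrier_mat\<close>)
qed

lemma transpose_adj_mat:
  assumes "A \<in> carrier_mat n n"
  shows "adj_mat (transpose_mat A) = transpose_mat (adj_mat A)"
proof (rule eq_matI)
  fix i j assume ij: "i < dim_row (transpose_mat (adj_mat A))" "j < dim_col (transpose_mat (adj_mat A))"
  then have ij: "i < n" "j < n" using assms by (auto simp: adj_mat_def)
  have "mat_delete (transpose_mat A) j i = transpose_mat (mat_delete A i j)"
    using assms ij by (intro eq_matI) (auto simp: mat_delete_def)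
  moreover have "mat_delete A i j \<in> carrier_mat (n - 1) (n - 1)"
    using assms by (auto simp: mat_delete_def)
  ultimately show "adj_mat (transpose_mat A) $$ (i, j) = transpose_mat (adj_mat A) $$ (i, j)"
    using assms ij by (simp add: adj_mat_def cofactor_def det_transpose add.commute)
qed (use assms in \<open>auto simp: adj_mat_def\<close>)

lemma transpose_adj_coeff:
  assumes A: "A \<in> carrier_mat n n" "transpose_mat A = A"
  shows "transpose_mat (adj_coeff k A) = adj_coeff k A"
proof -
  have "transpose_mat (char_poly_matrix A) = char_poly_matrix (transpose_mat A)"
    using A(1) by (intro eq_matI) (auto simp: char_poly_matrix_def)
  then show ?thesis
    using transpose_adj_mat[OF char_poly_matrix_closed[OF A(1)]] A(2)
    by (simp add: adj_coeff_def map_mat_transpose)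
qed

lemma coeff_char_order:
  assumes A: "A \<in> carrier_mat n n"
  shows "coeff (char_poly A) (char_order A) \<noteq> 0"
  unfolding char_order_def by (rule LeastI[of _ n]) (use degree_monic_char_poly[OF A] in simp)

lemma group_inv:
  assumes A: "A \<in> carrier_mat n n" and sym: "transpose_mat A = A"
  shows "group_inv A \<in> carrier_mat n n"
    and "transpose_mat (group_inv A) = group_inv A"
    and "A * group_inv A = group_inv A * A"
    and "A * (A * group_inv A) = A"
proof -
  note car[simp] = adj_coeff_carrier[OF A]
  have [simp]: "dim_row A = n" "dim_col A = n" using A by auto
  have [simp]: "dim_row (adj_coeff k A) = n" "dim_col (adj_coeff k A) = n" for k
    using carrier_matD[OF car[of k]] by blast+
  show N: "group_inv A \<in> carrier_mat n n" by (simp add: group_inv_def)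
  show "transpose_mat (group_inv A) = group_inv A"
    using transpose_adj_coeff[OF A sym, of "char_order A"]
    by (simp add: group_inv_def smult_mat_def map_mat_transpose)
  show "A * group_inv A = group_inv A * A"
    using adj_coeff_rec[OF A, of "char_order A"]
    by (simp add: group_inv_def mult_smult_distrib[OF A car] mult_smult_assoc_mat[OF car A])
  define d where "d = char_order A"
  \<comment> \<open>Below \<open>d\<close> the characteristic coefficients vanish, so the recursion
    reads \<open>A * adj_coeff (Suc k) A = adj_coeff k A\<close>. Hence \<open>A\<close> applied
    twice to the next coefficient is 0 by induction, and symmetry removes one of the two
    factors.\<close>
  have below: "A * adj_coeff k A = 0\<^sub>m n n" if "k < d" for k
    using that
  proof (induction k)
    case 0
    then have "coeff (char_poly A) 0 = 0" unfolding d_def char_order_def using not_less_Least by blast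
    then show ?case using adj_coeff_rec(1)[OF A, of 0] by auto
  next
    case (Suc k)
    then have "coeff (char_poly A) (Suc k) = 0" unfolding d_def char_order_def using not_less_Least by blast
    then have "A * adj_coeff (Suc k) A = adj_coeff k A"
      using adj_coeff_rec(1)[OF A, of "Suc k"] by (auto intro!: eq_matI)
    then show ?case using Suc by (intro symmetric_square_mult_eq_0[OF A sym car]) auto
  qed
  let ?c = "coeff (char_poly A) d"
  have c: "?c \<noteq> 0" using coeff_char_order[OF A] by (simp add: d_def)
  \<comment> \<open>At level \<open>d\<close> the recursion leaves the preceding coefficient and a
    scalar matrix; one more factor \<open>A\<close> kills the former by
    \<open>below\<close>.\<close>
  have "A * (A * adj_coeff d A) = (- ?c) \<cdot>\<^sub>m A"
  proof (cases d)
    case 0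
    then have "A * adj_coeff d A = 0\<^sub>m n n - ?c \<cdot>\<^sub>m 1\<^sub>m n"
      using adj_coeff_rec(1)[OF A, of d] by simp
    also have "\<dots> = (- ?c) \<cdot>\<^sub>m 1\<^sub>m n" by (intro eq_matI) auto
    finally show ?thesis using mult_smult_distrib[OF A, of "1\<^sub>m n" n "- ?c"] A by simp
  next
    case (Suc j)
    then have "A * adj_coeff d A = adj_coeff j A - ?c \<cdot>\<^sub>m 1\<^sub>m n"
      using adj_coeff_rec(1)[OF A, of d] by simp
    then have "A * (A * adj_coeff d A) = A * adj_coeff j A - A * (?c \<cdot>\<^sub>m 1\<^sub>m n)"
      using A by (simp add: mult_minus_distrib_mat[OF A car])
    also have "\<dots> = 0\<^sub>m n n - ?c \<cdot>\<^sub>m A"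
      using below[of j] Suc mult_smult_distrib[OF A, of "1\<^sub>m n" n "?c"] A by simp
    also have "\<dots> = (- ?c) \<cdot>\<^sub>m A" using A by (intro eq_matI) auto
    finally show ?thesis .
  qed
  moreover have "A * (A * group_inv A) = (- 1 / ?c) \<cdot>\<^sub>m (A * (A * adj_coeff d A))"
    unfolding group_inv_def d_def[symmetric] 
    using mult_smult_distrib[OF A car[of d], of "- 1 / ?c"]
      mult_smult_distrib[OF A mult_carrier_mat[OF A car[of d]], of "- 1 / ?c"] by simp
  ultimately show "A * (A * group_inv A) = A"
    using c by (auto intro!: eq_matI)
qed

text \<open>For \<open>Y = N * A * N\<close> both \<open>A * Y\<close> and \<open>Y * A\<close>
  collapse to \<open>A * N\<close>, which is symmetric because \<open>A\<close> and \<open>N\<close>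
  are symmetric and commute. This settles existence for the description operator in
  \<open>pinv\<close>.\<close>

lemma pinv_symmetric:
  assumes A: "A \<in> carrier_mat n n" and sym: "transpose_mat A = A"
  shows "penrose A (pinv A)"
    and "pinv A = group_inv A * A * group_inv A"
    and "transpose_mat (pinv A) = pinv A"
proof -
  let ?N = "group_inv A"
  note N = group_inv[OF A sym]
  have [simp]: "dim_row A = n" "dim_col A = n" "dim_row ?N = n" "dim_col ?N = n" using A N by auto
  have NA: "?N * A = A * ?N" using N(3) by simp
  have NAx: "?N * (A * X) = A * (?N * X)" if "dim_row X = n" for X
    using that NA by (simp add: mult_mat_assoc_dim[symmetric])
  have AANx: "A * (A * (?N * X)) = A * X" if "dim_row X = n" for X
    using that N(4) by (simp add: mult_mat_assoc_dim[symmetric])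
  let ?Y = "?N * A * ?N"
  have AY: "A * ?Y = A * ?N" and YA: "?Y * A = A * ?N"
    by (simp_all add: mult_mat_assoc_dim NA NAx AANx N(4))
  have AN: "transpose_mat (A * ?N) = A * ?N"
    using N(2) sym by (simp add: transpose_mult_dim NA)
  have "penrose A ?Y"
    unfolding penrose_def AY YA
  proof (intro conjI)
    show "?Y \<in> carrier_mat (dim_col A) (dim_row A)" by (intro carrier_matI) auto
    show "A * ?N * A = A" by (simp add: mult_mat_assoc_dim NA N(4))
    show "A * ?N * ?Y = ?Y" by (simp add: mult_mat_assoc_dim NA NAx AANx N(4))
  qed (rule AN)+
  then show "pinv A = ?Y" by (rule pinv_eqI)
  with \<open>penrose A ?Y\<close> show "penrose A (pinv A)" by simp
  show "transpose_mat (pinv A) = pinv A"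
    unfolding \<open>pinv A = ?Y\<close> using N(2) sym by (simp add: mult_mat_assoc_dim transpose_mult_dim)
qed

section \<open>Generalized Rayleigh quotient\<close>

text \<open>Vectors of length \<open>N\<close> are modelled by functions on the naturals that vanish
  from \<open>N\<close> on, so that Tychonoff's theorem applies and the extreme value theorem
  becomes available.\<close>

lemma compact_box_functions:
  fixes a b :: real
  shows "compact {f :: nat \<Rightarrow> real. (\<forall>i<N. a \<le> f i \<and> f i \<le> b) \<and> (\<forall>i\<ge>N. f i = 0)}"
proof -
  have "compactin (product_topology (\<lambda>_. euclidean) UNIV) (PiE UNIV (\<lambda>i. if i < N then {a..b} else {0::real}))"
    by (subst compactin_PiE) auto
  then have "compact (PiE UNIV (\<lambda>i. if i < N then {a..b} else {0::real}))"
    by (simp add: euclidean_product_topology)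
  also have "PiE UNIV (\<lambda>i. if i < N then {a..b} else {0::real}) =
     {f. (\<forall>i<N. a \<le> f i \<and> f i \<le> b) \<and> (\<forall>i\<ge>N. f i = 0)}"
    by (auto simp: PiE_UNIV_domain Pi_iff split: if_splits) 
  finally show ?thesis .
qed

lemma scalar_prod_mult_mat_vec:
  assumes "S \<in> carrier_mat N N" "v \<in> carrier_vec N" "w \<in> carrier_vec N"
  shows "scalar_prod v (S *\<^sub>v w) = (\<Sum>i<N. \<Sum>j<N. v $ i * S $$ (i, j) * w $ j)"
  using assms by (auto simp: scalar_prod_def atLeast0LessThan sum_distrib_left mult.assoc intro!: sum.cong)

lemma scalar_prod_symmetric_mat:
  fixes S :: "real mat"
  assumes S: "S \<in> carrier_mat N N" "transpose_mat S = S" and v: "v \<in> carrier_vec N" "w \<in> carrier_vec N"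
  shows "scalar_prod v (S *\<^sub>v w) = scalar_prod w (S *\<^sub>v v)"
  using transpose_vec_mult_scalar[OF S(1) v(2,1)] comm_scalar_prod[of "S *\<^sub>v v" N w] S v
  by auto

lemma symmetric_pos_def_nonneg:
  assumes "symmetric_pos_def N H" "v \<in> carrier_vec N"
  shows "0 \<le> scalar_prod v (H *\<^sub>v v)"
proof (cases "v = 0\<^sub>v N")
  case True
  then show ?thesis using assms
    by (auto simp: symmetric_pos_def_def intro!: eq_refl scalar_prod_left_zero[symmetric, of _ N])
qed (use assms in \<open>auto simp: symmetric_pos_def_def intro: less_imp_le\<close>)

lemma symmetric_pos_def_eq_0:
  assumes "symmetric_pos_def N H" "v \<in> carrier_vec N" "H *\<^sub>v v = 0\<^sub>v N"
  shows "v = 0\<^sub>v N"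
  using assms by (force simp: symmetric_pos_def_def)

lemma quadratic_form_smult:
  fixes S :: "real mat"
  assumes "S \<in> carrier_mat N N" "v \<in> carrier_vec N"
  shows "scalar_prod (c \<cdot>\<^sub>v v) (S *\<^sub>v (c \<cdot>\<^sub>v v)) = c\<^sup>2 * scalar_prod v (S *\<^sub>v v)"
  using assms by (simp add: mult_mat_vec power2_eq_square mult.assoc)

lemma minus_vec_eq_0:
  fixes v w :: "'a :: ab_group_add Matrix.vec"
  assumes "v \<in> carrier_vec N" "w \<in> carrier_vec N" "v - w = 0\<^sub>v N"
  shows "v = w"
proof (rule eq_vecI)
  fix i assume i: "i < dim_vec w"
  then have "(v - w) $ i = 0" using assms(2,3) by simp
  then show "v $ i = w $ i" using index_minus_vec(1)[OF i, of v] by simp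
qed (use assms in simp)

lemma symmetric_pos_def_one: "symmetric_pos_def n (1\<^sub>m n)"
  unfolding symmetric_pos_def_def
proof (intro conjI ballI impI)
  fix v :: "real Matrix.vec" assume v: "v \<in> carrier_vec n" "v \<noteq> 0\<^sub>v n"
  have "scalar_prod v v \<noteq> 0" "scalar_prod v v \<ge> 0"
    using v scalar_prod_self_eq_0[of v] by (auto simp: scalar_prod_def sum_nonneg)
  then show "0 < scalar_prod v (1\<^sub>m n *\<^sub>v v)" using v by simp
qed auto

text \<open>The quotient of the two quadratic forms is continuous on the compact Euclidean unit
  sphere, its denominator being positive there, and attains its minimum \<open>l\<close>. Both forms
  scale by the same square, so the bound extends to all nonzero vectors.\<close>

lemma rayleigh_minimizer:
  fixes S H :: "real mat"
  assumes N: "0 < N" and S: "S \<in> carrier_mat N N" and H: "symmetric_pos_def N H"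
  obtains v l where "v \<in> carrier_vec N" "v \<noteq> 0\<^sub>v N"
    "scalar_prod v (S *\<^sub>v v) = l * scalar_prod v (H *\<^sub>v v)"
    "\<And>w. w \<in> carrier_vec N \<Longrightarrow> l * scalar_prod w (H *\<^sub>v w) \<le> scalar_prod w (S *\<^sub>v w)"
proof -
  have Hc: "H \<in> carrier_mat N N" using H by (simp add: symmetric_pos_def_def)
  define K where "K = {f :: nat \<Rightarrow> real. (\<forall>i<N. -1 \<le> f i \<and> f i \<le> 1) \<and> (\<forall>i\<ge>N. f i = 0)} \<inter>
    {f. (\<Sum>i<N. (f i)\<^sup>2) = 1}"
  define q where "q = (\<lambda>(A::real mat) (f::nat\<Rightarrow>real). \<Sum>i<N. \<Sum>j<N. f i * A $$ (i, j) * f j)"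
  have cont [continuous_intros]: "continuous_on T (\<lambda>f::nat\<Rightarrow>real. f i)" for T i
    by (rule continuous_on_product_then_coordinatewise) (rule continuous_on_id)
  have "closed {f::nat\<Rightarrow>real. (\<Sum>i<N. (f i)\<^sup>2) = 1}"
    by (intro closed_Collect_eq continuous_intros)
  then have K: "compact K"
    unfolding K_def by (intro compact_Int_closed compact_box_functions)
  have "(\<lambda>i. if i = 0 then 1 else 0) \<in> K"
    using N by (auto simp: K_def if_distrib[of "\<lambda>x. x\<^sup>2"] cong: if_cong)
  then have "K \<noteq> {}" by blast
  have q: "scalar_prod (Matrix.vec N f) (A *\<^sub>v Matrix.vec N f) = q A f" if "A \<in> carrier_mat N N" for A f
    using that by (simp add: scalar_prod_mult_mat_vec[where N = N] q_def)
  have nz: "Matrix.vec N f \<noteq> 0\<^sub>v N" if "f \<in> K" for f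
  proof
    assume "Matrix.vec N f = 0\<^sub>v N"
    then have "f i = 0" if "i < N" for i
      using that by (metis index_vec index_zero_vec(1))
    then show False using \<open>f \<in> K\<close> by (simp add: K_def)
  qed
  have pos: "q H f > 0" if "f \<in> K" for f
    using nz[OF that] H q[OF Hc, of f] by (auto simp: symmetric_pos_def_def)
  have "continuous_on K (\<lambda>f. q S f / q H f)"
    unfolding q_def
    by (intro continuous_intros) (use pos in \<open>fastforce simp: q_def\<close>)
  then obtain f where f: "f \<in> K" and min: "\<And>g. g \<in> K \<Longrightarrow> q S f / q H f \<le> q S g / q H g"
    using continuous_attains_inf[OF K \<open>K \<noteq> {}\<close>] by blast
  define l where "l = q S f / q H f"
  have "l * scalar_prod w (H *\<^sub>v w) \<le> scalar_prod w (S *\<^sub>v w)" if w: "w \<in> carrier_vec N" for w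
  proof (cases "w = 0\<^sub>v N")
    case True
    then show ?thesis using S Hc by simp
  next
    case False
    define r where "r = sqrt (\<Sum>i<N. (w $ i)\<^sup>2)"
    obtain i where i: "i < N" "w $ i \<noteq> 0" using False w by (metis carrier_vecD eq_vecI index_zero_vec)
    have r2: "(\<Sum>i<N. (w $ i)\<^sup>2) > 0"
      by (rule sum_pos2[of _ i]) (use i in auto)
    then have r: "r > 0" and rsq: "r\<^sup>2 = (\<Sum>i<N. (w $ i)\<^sup>2)" by (auto simp: r_def)
    define g where "g = (\<lambda>i. if i < N then w $ i / r else 0)"
    have sum1: "(\<Sum>i<N. (g i)\<^sup>2) = 1"
      using r2 by (simp add: g_def power_divide sum_divide_distrib[symmetric] rsq)
    have "(g i)\<^sup>2 \<le> 1" if "i < N" for i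
      using member_le_sum[of i "{..<N}" "\<lambda>i. (g i)\<^sup>2"] that sum1 by simp
    then have "-1 \<le> g i \<and> g i \<le> 1" if "i < N" for i
      using that abs_square_le_1[of "g i"] by (auto simp: abs_le_iff)
    moreover have "g i = 0" if "i \<ge> N" for i using that by (simp add: g_def)
    ultimately have "g \<in> K"
      using sum1 by (simp add: K_def)
    have wg: "w = r \<cdot>\<^sub>v Matrix.vec N g"
      using w r by (intro eq_vecI) (auto simp: g_def)
    have "l \<le> q S g / q H g" unfolding l_def by (rule min[OF \<open>g \<in> K\<close>])
    then have "l * q H g \<le> q S g"
      using pos[OF \<open>g \<in> K\<close>] by (simp add: pos_le_divide_eq)
    then show ?thesis unfolding wg
      using r by (simp add: quadratic_form_smult[OF S] quadratic_form_smult[OF Hc] q[OF S] q[OF Hc])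
  qed
  moreover have "scalar_prod (Matrix.vec N f) (S *\<^sub>v Matrix.vec N f) =
      l * scalar_prod (Matrix.vec N f) (H *\<^sub>v Matrix.vec N f)"
    using pos[OF f] by (simp add: q[OF S] q[OF Hc] l_def)
  ultimately show thesis using that nz[OF f] by (metis vec_carrier)
qed

text \<open>The form of \<open>S - l H\<close> is nonnegative and vanishes at the minimizer
  \<open>v\<close>, so \<open>v\<close> is a critical point. Perturbing in the direction of the
  residual \<open>u\<close> itself makes the linear term a multiple of the squared length of
  \<open>u\<close>, which forces \<open>u\<close> to be zero.\<close>

lemma rayleigh_eigenvector:
  fixes S H :: "real mat"
  assumes N: "0 < N" and S: "S \<in> carrier_mat N N" "transpose_mat S = S" and H: "symmetric_pos_def N H"
  obtains v l where "v \<in> carrier_vec N" "v \<noteq> 0\<^sub>v N" "S *\<^sub>v v = l \<cdot>\<^sub>v (H *\<^sub>v v)"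
    "\<And>w. w \<in> carrier_vec N \<Longrightarrow> l * scalar_prod w (H *\<^sub>v w) \<le> scalar_prod w (S *\<^sub>v w)"
proof -
  have Hc: "H \<in> carrier_mat N N" "transpose_mat H = H" using H by (auto simp: symmetric_pos_def_def)
  obtain v l where v: "v \<in> carrier_vec N" "v \<noteq> 0\<^sub>v N"
    "scalar_prod v (S *\<^sub>v v) = l * scalar_prod v (H *\<^sub>v v)"
    and le: "\<And>w. w \<in> carrier_vec N \<Longrightarrow> l * scalar_prod w (H *\<^sub>v w) \<le> scalar_prod w (S *\<^sub>v w)"
    using rayleigh_minimizer[OF N S(1) H] by blast
  define u where "u = S *\<^sub>v v - l \<cdot>\<^sub>v (H *\<^sub>v v)"
  have u: "u \<in> carrier_vec N" using S Hc v by (simp add: u_def)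
  define c where "c = scalar_prod u (S *\<^sub>v u) - l * scalar_prod u (H *\<^sub>v u)"
  have uu: "scalar_prod u (S *\<^sub>v v) - l * scalar_prod u (H *\<^sub>v v) = scalar_prod u u"
  proof -
    have "scalar_prod u u = scalar_prod u (S *\<^sub>v v) - scalar_prod u (l \<cdot>\<^sub>v (H *\<^sub>v v))"
      using scalar_prod_minus_distrib[OF u, of "S *\<^sub>v v" "l \<cdot>\<^sub>v (H *\<^sub>v v)"] S Hc v
      by (simp add: u_def[symmetric])
    then show ?thesis using scalar_prod_smult_distrib[OF u, of "H *\<^sub>v v" l] Hc v by simp
  qed
  \<comment> \<open>first variation of the form \<open>S - l H\<close> at its minimizer \<open>v\<close> in the direction \<open>u\<close>\<close>
  have var: "0 \<le> 2 * t * scalar_prod u u + t\<^sup>2 * c" for t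
  proof -
    have exp: "scalar_prod (v + t \<cdot>\<^sub>v u) (A *\<^sub>v (v + t \<cdot>\<^sub>v u)) =
       scalar_prod v (A *\<^sub>v v) + 2 * t * scalar_prod u (A *\<^sub>v v) + t\<^sup>2 * scalar_prod u (A *\<^sub>v u)"
      if A: "A \<in> carrier_mat N N" "transpose_mat A = A" for A
    proof -
      have "A *\<^sub>v (v + t \<cdot>\<^sub>v u) = A *\<^sub>v v + t \<cdot>\<^sub>v (A *\<^sub>v u)"
        using A v u by (simp add: mult_add_distrib_mat_vec mult_mat_vec)
      then show ?thesis
        using A u v scalar_prod_symmetric_mat[OF A v(1) u]
        by (simp add: add_scalar_prod_distrib[of _ N] scalar_prod_add_distrib[of _ N] power2_eq_square
            algebra_simps)
    qed
    have "0 \<le> scalar_prod (v + t \<cdot>\<^sub>v u) (S *\<^sub>v (v + t \<cdot>\<^sub>v u)) - l * scalar_prod (v + t \<cdot>\<^sub>v u) (H *\<^sub>v (v + t \<cdot>\<^sub>v u))"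
      using le[of "v + t \<cdot>\<^sub>v u"] u v by simp
    also have "\<dots> = 2 * t * (scalar_prod u (S *\<^sub>v v) - l * scalar_prod u (H *\<^sub>v v)) + t\<^sup>2 * c"
      unfolding exp[OF S] exp[OF Hc] c_def using v(3) by (simp add: algebra_simps)
    finally show ?thesis unfolding uu .
  qed
  have "scalar_prod u u \<ge> 0" by (simp add: scalar_prod_def sum_nonneg)
  moreover have "\<not> scalar_prod u u > 0"
  proof
    assume p: "scalar_prod u u > 0"
    \<comment> \<open>The step \<open>t = - s\<close> is so short that the quadratic term cannot
      compensate the linear one: \<open>s * c\<close> is at most the squared length of
      \<open>u\<close>, while \<open>var\<close> demands twice that length. Adding 1 keeps the
      denominator positive.\<close>
    define s where "s = scalar_prod u u / (\<bar>c\<bar> + 1)"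
    have s: "s > 0" "s * (\<bar>c\<bar> + 1) = scalar_prod u u" using p by (auto simp: s_def)
    have "0 \<le> s * (s * c - 2 * scalar_prod u u)"
      using var[of "- s"] by (simp add: power2_eq_square algebra_simps)
    then have "2 * scalar_prod u u \<le> s * c" using s(1) by (simp add: zero_le_mult_iff)
    also have "\<dots> \<le> s * (\<bar>c\<bar> + 1)" using s(1) by (intro mult_left_mono) auto
    finally show False using p s(2) by simp
  qed
  ultimately have "scalar_prod u u = 0" by simp
  then have "u = 0\<^sub>v N" using u by (simp add: scalar_prod_self_eq_0)
  then have "S *\<^sub>v v = l \<cdot>\<^sub>v (H *\<^sub>v v)"
    unfolding u_def by (rule minus_vec_eq_0[rotated 2]) (use S Hc v in auto)
  then show thesis using that v le by blast
qed

text \<open>Apply the preceding lemma to \<open>S = H * Z\<close>. Injectivity of \<open>H\<close>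
  cancels it from \<open>H Z v = l H v\<close>, so the minimum \<open>l\<close> of the quotient is a
  genuine eigenvalue of \<open>Z\<close>; in particular the minimum in \<open>lambda_min\<close> is
  over a nonempty finite set.\<close>

lemma lambda_min_le_rayleigh:
  fixes H Z :: "real mat"
  assumes N: "0 < N" and H: "symmetric_pos_def N H" and Z: "Z \<in> carrier_mat N N"
    and sym: "transpose_mat (H * Z) = H * Z" and w: "w \<in> carrier_vec N"
  shows "lambda_min Z * scalar_prod w (H *\<^sub>v w) \<le> scalar_prod w ((H * Z) *\<^sub>v w)"
proof -
  have Hc: "H \<in> carrier_mat N N" using H by (simp add: symmetric_pos_def_def)
  obtain v l where v: "v \<in> carrier_vec N" "v \<noteq> 0\<^sub>v N" and eig: "(H * Z) *\<^sub>v v = l \<cdot>\<^sub>v (H *\<^sub>v v)"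
    and le: "\<And>w. w \<in> carrier_vec N \<Longrightarrow> l * scalar_prod w (H *\<^sub>v w) \<le> scalar_prod w ((H * Z) *\<^sub>v w)"
    using rayleigh_eigenvector[OF N mult_carrier_mat[OF Hc Z] sym H] by blast
  have "H *\<^sub>v (Z *\<^sub>v v - l \<cdot>\<^sub>v v) = 0\<^sub>v N"
    using eig Hc Z v by (simp add: mult_minus_distrib_mat_vec[OF Hc] mult_mat_vec[OF Hc])
  then have "Z *\<^sub>v v - l \<cdot>\<^sub>v v = 0\<^sub>v N"
    by (rule symmetric_pos_def_eq_0[OF H, rotated]) (use Z v in auto)
  then have "Z *\<^sub>v v = l \<cdot>\<^sub>v v"
    by (rule minus_vec_eq_0[rotated 2]) (use Z v in auto)
  then have "l \<in> spectrum Z"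
    using v Z by (auto simp: spectrum_def eigenvalue_def eigenvector_def)
  then have "lambda_min Z \<le> l"
    unfolding lambda_min_def using card_finite_spectrum(1)[OF Z] by (rule_tac Min_le)
  then show ?thesis
    using le[OF w] symmetric_pos_def_nonneg[OF H w] by (smt (verit) mult_right_mono)
qed

text \<open>The constant is the least Rayleigh quotient of \<open>H\<close> against the identity; it
  is positive because it is attained.\<close>

lemma symmetric_pos_def_coercive:
  assumes H: "symmetric_pos_def N H"
  obtains c where "c > 0" "\<And>w. w \<in> carrier_vec N \<Longrightarrow> c * scalar_prod w w \<le> scalar_prod w (H *\<^sub>v w)"
proof (cases "N = 0")
  case True
  then have "scalar_prod w w \<le> scalar_prod w (H *\<^sub>v w)" if "w \<in> carrier_vec N" for w
    using that H by (simp add: scalar_prod_def symmetric_pos_def_def)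
  then show thesis using that[of 1] by simp
next
  case False
  have Hc: "H \<in> carrier_mat N N" using H by (simp add: symmetric_pos_def_def)
  obtain v l where v: "v \<in> carrier_vec N" "v \<noteq> 0\<^sub>v N"
    "scalar_prod v (H *\<^sub>v v) = l * scalar_prod v (1\<^sub>m N *\<^sub>v v)"
    and le: "\<And>w. w \<in> carrier_vec N \<Longrightarrow> l * scalar_prod w (1\<^sub>m N *\<^sub>v w) \<le> scalar_prod w (H *\<^sub>v w)"
    using rayleigh_minimizer[OF _ Hc symmetric_pos_def_one] False by auto
  have "l * scalar_prod v (1\<^sub>m N *\<^sub>v v) > 0" using v H by (auto simp: symmetric_pos_def_def)
  moreover have "scalar_prod v (1\<^sub>m N *\<^sub>v v) > 0"
    using v(1,2) symmetric_pos_def_one[of N] by (simp add: symmetric_pos_def_def del: one_mult_mat_vec)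
  ultimately have "l > 0" by (simp add: zero_less_mult_iff)
  then show thesis using that[of l] le by auto
qed

section \<open>Kronecker products and the sketched projections\<close>

definition stack :: "real mat \<Rightarrow> real Matrix.vec" where
  "stack Y = Matrix.vec (dim_col Y * dim_row Y) (\<lambda>i. Y $$ (i mod dim_row Y, i div dim_row Y))"

text \<open>The range up to \<open>n * m\<close> is cut into \<open>n\<close> blocks of length
  \<open>m\<close>. This turns every sum over a Kronecker or stacked index into a double
  sum.\<close>

lemma sum_div_mod:
  fixes f :: "nat \<Rightarrow> nat \<Rightarrow> 'a :: comm_monoid_add"
  shows "(\<Sum>i<n * m. f (i div m) (i mod m)) = (\<Sum>a<n. \<Sum>b<m. f a b)"
proof -
  have "(\<Sum>i<n * m. f (i div m) (i mod m)) = (\<Sum>a<n. \<Sum>i\<in>{a * m..<a * m + m}. f (i div m) (i mod m))"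
    by (rule sum.nat_group[symmetric])
  also have "\<dots> = (\<Sum>a<n. \<Sum>b<m. f a b)"
  proof (rule sum.cong[OF refl])
    fix a
    have dm: "i div m = a" "i mod m = i - a * m" if "a * m \<le> i" "i < a * m + m" for i
    proof -
      show "i div m = a" using that by (intro div_nat_eqI) (auto simp: mult.commute)
      then show "i mod m = i - a * m" by (simp add: minus_div_mult_eq_mod[symmetric])
    qed
    show "(\<Sum>i\<in>{a * m..<a * m + m}. f (i div m) (i mod m)) = (\<Sum>b<m. f a b)"
      by (rule sum.reindex_bij_witness[of _ "\<lambda>b. a * m + b" "\<lambda>i. i - a * m"]) (auto simp: dm)
  qed
  finally show ?thesis .
qed

lemma less_mult_div_mod:
  fixes i n m :: nat
  assumes "i < n * m"
  shows "i div m < n" "i mod m < m"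
  using assms by (auto simp: less_mult_imp_div_less intro!: mod_less_divisor) (metis mult_0_right not_less_zero gr0I)

lemma dim_kronecker [simp]:
  "dim_row (kronecker A B) = dim_row A * dim_row B" "dim_col (kronecker A B) = dim_col A * dim_col B"
  by (auto simp: kronecker_def)

lemma dim_stack [simp]: "dim_vec (stack Y) = dim_col Y * dim_row Y"
  by (simp add: stack_def)

lemma transpose_kronecker: "transpose_mat (kronecker A B) = kronecker (transpose_mat A) (transpose_mat B)"
  by (rule eq_matI) (auto simp: kronecker_def less_mult_div_mod)

text \<open>The mixed-product rule: the sum over the inner index factors after splitting it into
  blocks. It carries idempotence and self-adjointness from the two factors to their Kronecker
  product.\<close>

lemma kronecker_mult:
  assumes "dim_col A = dim_row C" "dim_col B = dim_row D"
  shows "kronecker A B * kronecker C D = kronecker (A * C) (B * D)"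
proof (rule eq_matI)
  fix i j assume "i < dim_row (kronecker (A * C) (B * D))" "j < dim_col (kronecker (A * C) (B * D))"
  then have i: "i < dim_row A * dim_row B" and j: "j < dim_col C * dim_col D" by auto
  note ij = less_mult_div_mod[OF i] less_mult_div_mod[OF j]
  have "(kronecker A B * kronecker C D) $$ (i, j) =
     (\<Sum>l<dim_row C * dim_row D. A $$ (i div dim_row B, l div dim_row D) * B $$ (i mod dim_row B, l mod dim_row D) *
        (C $$ (l div dim_row D, j div dim_col D) * D $$ (l mod dim_row D, j mod dim_col D)))"
    using i j assms by (simp add: scalar_prod_def atLeast0LessThan kronecker_def)
  also have "\<dots> = (\<Sum>a<dim_row C. \<Sum>b<dim_row D. A $$ (i div dim_row B, a) * B $$ (i mod dim_row B, b) *
        (C $$ (a, j div dim_col D) * D $$ (b, j mod dim_col D)))"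
    by (rule sum_div_mod)
  also have "\<dots> = kronecker (A * C) (B * D) $$ (i, j)"
    using i j ij assms
    by (simp add: scalar_prod_def atLeast0LessThan kronecker_def sum_product algebra_simps)
  finally show "(kronecker A B * kronecker C D) $$ (i, j) = kronecker (A * C) (B * D) $$ (i, j)" .
qed auto

text \<open>Stacking is column by column, which matches the left factor acting on column indices.
  The transpose disappears in the application because \<open>Z2\<close> is symmetric.\<close>

lemma kronecker_mult_stack:
  assumes "dim_col A = dim_col Y" "dim_col B = dim_row Y"
  shows "kronecker A B *\<^sub>v stack Y = stack (B * Y * transpose_mat A)"
proof (rule eq_vecI)
  fix i assume "i < dim_vec (stack (B * Y * transpose_mat A))"
  then have i: "i < dim_row A * dim_row B" by simp
  note ij = less_mult_div_mod[OF i]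
  have "(kronecker A B *\<^sub>v stack Y) $ i =
     (\<Sum>l<dim_col Y * dim_row Y. A $$ (i div dim_row B, l div dim_row Y) * B $$ (i mod dim_row B, l mod dim_row Y) *
        Y $$ (l mod dim_row Y, l div dim_row Y))"
    using i assms by (simp add: scalar_prod_def atLeast0LessThan kronecker_def stack_def)
  also have "\<dots> = (\<Sum>a<dim_col Y. \<Sum>b<dim_row Y. A $$ (i div dim_row B, a) * B $$ (i mod dim_row B, b) * Y $$ (b, a))"
    by (rule sum_div_mod)
  also have "\<dots> = stack (B * Y * transpose_mat A) $ i"
    using i ij assms
    by (simp add: scalar_prod_def atLeast0LessThan stack_def sum_distrib_left sum_distrib_right algebra_simps)
  finally show "(kronecker A B *\<^sub>v stack Y) $ i = stack (B * Y * transpose_mat A) $ i" .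
qed auto

lemma scalar_prod_stack:
  assumes "dim_row Y = dim_row W" "dim_col Y = dim_col W"
  shows "scalar_prod (stack Y) (stack W) = mat_trace (transpose_mat Y * W)"
proof -
  have "scalar_prod (stack Y) (stack W) = (\<Sum>l<dim_col W * dim_row W. Y $$ (l mod dim_row W, l div dim_row W) *
        W $$ (l mod dim_row W, l div dim_row W))"
    using assms by (simp add: scalar_prod_def atLeast0LessThan stack_def)
  also have "\<dots> = (\<Sum>a<dim_col W. \<Sum>b<dim_row W. Y $$ (b, a) * W $$ (b, a))"
    by (rule sum_div_mod)
  also have "\<dots> = mat_trace (transpose_mat Y * W)"
    using assms by (simp add: mat_trace_def scalar_prod_def atLeast0LessThan)
  finally show ?thesis .
qed

lemma stack_minus:
  assumes "dim_row Y = dim_row W" "dim_col Y = dim_col W"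
  shows "stack (Y - W) = stack Y - stack W"
  by (rule eq_vecI) (use assms in \<open>auto simp: stack_def less_mult_div_mod\<close>)

lemma stack_surj:
  assumes "v \<in> carrier_vec (n * m)"
  obtains Y where "Y \<in> carrier_mat m n" "stack Y = v"
proof
  define Y where "Y = Matrix.mat m n (\<lambda>(b, a). v $ (a * m + b))"
  show "Y \<in> carrier_mat m n" by (simp add: Y_def)
  show "stack Y = v"
    by (rule eq_vecI) (use assms in \<open>auto simp: stack_def Y_def less_mult_div_mod\<close>)
qed

lemma frob_norm_sq_stack:
  assumes "G \<in> carrier_mat m m" "Y \<in> carrier_mat m n"
  shows "frob_norm_sq G Y = scalar_prod (stack Y) (kronecker (1\<^sub>m n) G *\<^sub>v stack Y)"
  using assms by (simp add: kronecker_mult_stack scalar_prod_stack frob_norm_sq_def mult_mat_assoc_dim)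

text \<open>The matrix is block diagonal with \<open>n\<close> copies of \<open>G\<close>, so its
  form is the sum of the forms of \<open>G\<close> over the columns of the unstacked matrix.\<close>

lemma symmetric_pos_def_kronecker:
  assumes G: "symmetric_pos_def m G"
  shows "symmetric_pos_def (n * m) (kronecker (1\<^sub>m n) G)"
  unfolding symmetric_pos_def_def
proof (intro conjI ballI impI)
  have Gc: "G \<in> carrier_mat m m" "transpose_mat G = G" using G by (auto simp: symmetric_pos_def_def)
  show "kronecker (1\<^sub>m n) G \<in> carrier_mat (n * m) (n * m)" using Gc by (intro carrier_matI) auto
  show "transpose_mat (kronecker (1\<^sub>m n) G) = kronecker (1\<^sub>m n) G" using Gc by (simp add: transpose_kronecker)
  fix v :: "real Matrix.vec" assume v: "v \<in> carrier_vec (n * m)" "v \<noteq> 0\<^sub>v (n * m)"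
  obtain Y where Y: "Y \<in> carrier_mat m n" "stack Y = v" using stack_surj[OF v(1)] .
  have eq: "scalar_prod v (kronecker (1\<^sub>m n) G *\<^sub>v v) = (\<Sum>j<n. scalar_prod (col Y j) (G *\<^sub>v col Y j))"
    using Gc Y unfolding Y(2)[symmetric] frob_norm_sq_stack[OF Gc(1) Y(1), symmetric]
    by (simp add: frob_norm_sq_def mat_trace_def mult_mat_assoc_dim col_mult2[of G m m Y n] mult_mat_vec_def)
  have "\<exists>j<n. col Y j \<noteq> 0\<^sub>v m"
  proof (rule ccontr)
    assume *: "\<not> ?thesis"
    have "Y $$ (i, j) = 0" if "i < m" "j < n" for i j
    proof -
      have "col Y j $ i = 0\<^sub>v m $ i" using * that by simp
      then show ?thesis using that Y by simp
    qed
    then have "v = 0\<^sub>v (n * m)"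
      unfolding Y(2)[symmetric] using Y(1) by (intro eq_vecI) (auto simp: stack_def less_mult_div_mod)
    then show False using v by simp
  qed
  then obtain j where "j < n" "col Y j \<noteq> 0\<^sub>v m" by blast
  then show "0 < scalar_prod v (kronecker (1\<^sub>m n) G *\<^sub>v v)"
    unfolding eq using G Y
    by (intro sum_pos2[of _ j] symmetric_pos_def_nonneg[OF G]) (auto simp: symmetric_pos_def_def)
qed

section \<open>The sketched projections\<close>

lemma inv_mat_symmetric_pos_def:
  assumes "symmetric_pos_def m G"
  shows "inv_mat G \<in> carrier_mat m m" "G * inv_mat G = 1\<^sub>m m" "inv_mat G * G = 1\<^sub>m m"
    "transpose_mat (inv_mat G) = inv_mat G"
proof -
  have G: "G \<in> carrier_mat m m" "transpose_mat G = G" using assms by (auto simp: symmetric_pos_def_def)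
  \<comment> \<open>Definiteness makes \<open>G\<close> injective; a nonzero determinant then
    guarantees that \<open>mat_inverse\<close> returns a value.\<close>
  have "det G \<noteq> 0"
    using symmetric_pos_def_eq_0[OF assms] by (auto simp: det_0_iff_vec_prod_zero_field[OF G(1)])
  then have "G \<in> Units (ring_mat TYPE(real) m ())" by (rule det_non_zero_imp_unit[OF G(1)])
  then obtain Gi where "mat_inverse G = Some Gi"
    using mat_inverse(1)[OF G(1), of "()"] by (cases "mat_inverse G") auto
  then have I: "inv_mat G = Gi" "G * Gi = 1\<^sub>m m" "Gi * G = 1\<^sub>m m" "Gi \<in> carrier_mat m m"
    using mat_inverse(2)[OF G(1)] by (auto simp: inv_mat_def)
  then show "inv_mat G \<in> carrier_mat m m" "G * inv_mat G = 1\<^sub>m m" "inv_mat G * G = 1\<^sub>m m" by auto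
  have "transpose_mat Gi * G = transpose_mat (G * Gi)"
    using I(4) G by (simp add: transpose_mult[OF G(1) I(4)])
  then have GiG: "transpose_mat Gi * G = 1\<^sub>m m" by (simp add: I(2))
  have "transpose_mat Gi = transpose_mat Gi * (G * Gi)" using I(2,4) by simp
  also have "\<dots> = transpose_mat Gi * G * Gi" using I(4) G(1) by (simp add: mult_mat_assoc_dim)
  also have "\<dots> = Gi" using GiG I(4) by simp
  finally show "transpose_mat (inv_mat G) = inv_mat G" using I(1) by simp
qed

lemma sketch_gram_symmetric:
  assumes "symmetric_pos_def m G" "A \<in> carrier_mat p m" "S \<in> carrier_mat p c"
  defines "W \<equiv> transpose_mat S * A * inv_mat G * transpose_mat A * S"
  shows "W \<in> carrier_mat c c" "transpose_mat W = W"
  using inv_mat_symmetric_pos_def[OF assms(1)] assms(2,3) unfolding W_def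
  by (auto simp: mult_mat_assoc_dim transpose_mult_dim intro!: carrier_matI)

text \<open>Squaring produces the sketched Gram matrix \<open>W\<close> between two copies of its
  pseudoinverse \<open>Y\<close>, and \<open>Y * W * Y = Y\<close> collapses it. Multiplying by
  \<open>G\<close> cancels the inverse in front and leaves a congruence transform of the symmetric
  \<open>Y\<close>.\<close>

lemma Z1'_projection:
  assumes G: "symmetric_pos_def m G" and A: "A \<in> carrier_mat p m" and S: "S \<in> carrier_mat p c"
  shows "Z1' G A S \<in> carrier_mat m m"
    and "Z1' G A S * Z1' G A S = Z1' G A S"
    and "transpose_mat (G * Z1' G A S) = G * Z1' G A S"
proof -
  define W where "W = transpose_mat S * A * inv_mat G * transpose_mat A * S"
  have W: "W \<in> carrier_mat c c" "transpose_mat W = W"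
    unfolding W_def by (fact sketch_gram_symmetric[OF G A S])+
  define Y where "Y = pinv W"
  have Y: "Y \<in> carrier_mat c c" "Y * W * Y = Y" "transpose_mat Y = Y"
    using pinv_symmetric[OF W] W(1) by (auto simp: Y_def penrose_def)
  note I = inv_mat_symmetric_pos_def[OF G]
  have Gc: "G \<in> carrier_mat m m" "transpose_mat G = G" using G by (auto simp: symmetric_pos_def_def)
  have [simp]: "dim_row G = m" "dim_col G = m" "dim_row A = p" "dim_col A = m" "dim_row S = p" "dim_col S = c"
    "dim_row Y = c" "dim_col Y = c" "dim_row (inv_mat G) = m" "dim_col (inv_mat G) = m"
    using Gc A S Y I by auto
  have Z: "Z1' G A S = inv_mat G * (transpose_mat A * (S * (Y * (transpose_mat S * A))))"
    unfolding Z1'_def W_def[symmetric] Y_def[symmetric] by (simp add: mult_mat_assoc_dim)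
  show "Z1' G A S \<in> carrier_mat m m" unfolding Z by (intro carrier_matI) auto
  have "Y * (transpose_mat S * (A * (inv_mat G * (transpose_mat A * (S * (Y * X)))))) = Y * X"
    if "dim_row X = c" for X
  proof -
    have "Y * (transpose_mat S * (A * (inv_mat G * (transpose_mat A * (S * (Y * X)))))) = (Y * W * Y) * X"
      unfolding W_def using that by (simp add: mult_mat_assoc_dim)
    then show ?thesis by (simp add: Y(2))
  qed
  then show "Z1' G A S * Z1' G A S = Z1' G A S"
    unfolding Z by (simp add: mult_mat_assoc_dim)
  have "G * Z1' G A S = transpose_mat A * (S * (Y * (transpose_mat S * A)))"
  proof -
    have "G * Z1' G A S = (G * inv_mat G) * (transpose_mat A * (S * (Y * (transpose_mat S * A))))"
      unfolding Z by (simp add: mult_mat_assoc_dim)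
    then show ?thesis using I(2) by simp
  qed
  then show "transpose_mat (G * Z1' G A S) = G * Z1' G A S"
    using Y(3) by (simp add: transpose_mult_dim mult_mat_assoc_dim)
qed

text \<open>\<open>Z2\<close> is the case of identity weight and transposed coefficient matrix, so
  its projection properties and measurability come from those of \<open>Z1'\<close>.\<close>

lemma Z2_eq_Z1':
  assumes "B \<in> carrier_mat n q" "P \<in> carrier_mat q c"
  shows "Z2 B P = Z1' (1\<^sub>m n) (transpose_mat B) P"
proof -
  have "inv_mat (1\<^sub>m n) = (1\<^sub>m n :: real mat)"
    using inv_mat_symmetric_pos_def[OF symmetric_pos_def_one[of n]]
    by (metis left_mult_one_mat)
  then show ?thesis using assms by (simp add: Z1'_def Z2_def)
qed

section \<open>Measurability\<close>

text \<open>For values of one fixed shape; entries outside the shape are unspecified and must not be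
  constrained.\<close>

definition entries_measurable :: "'a measure \<Rightarrow> nat \<Rightarrow> nat \<Rightarrow> ('a \<Rightarrow> 'b :: topological_space mat) \<Rightarrow> bool" where
  "entries_measurable N r c F \<longleftrightarrow> (\<forall>x\<in>space N. F x \<in> carrier_mat r c) \<and>
     (\<forall>i<r. \<forall>j<c. (\<lambda>x. F x $$ (i, j)) \<in> borel_measurable N)"

lemma entries_measurable_const: "A \<in> carrier_mat r c \<Longrightarrow> entries_measurable N r c (\<lambda>_. A)"
  by (simp add: entries_measurable_def)

lemma entries_measurable_transpose:
  "entries_measurable N r c F \<Longrightarrow> entries_measurable N c r (\<lambda>x. transpose_mat (F x))"
  unfolding entries_measurable_def
proof (intro conjI ballI allI impI; elim conjE)
  fix i j assume ij: "i < c" "j < r" and car: "\<forall>x\<in>space N. F x \<in> carrier_mat r c"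
    and "\<forall>i<r. \<forall>j<c. (\<lambda>x. F x $$ (i, j)) \<in> borel_measurable N"
  then have "(\<lambda>x. F x $$ (j, i)) \<in> borel_measurable N" by blast
  also have "?this \<longleftrightarrow> (\<lambda>x. transpose_mat (F x) $$ (i, j)) \<in> borel_measurable N"
    by (rule measurable_cong) (use ij car in auto)
  finally show "(\<lambda>x. transpose_mat (F x) $$ (i, j)) \<in> borel_measurable N" .
qed auto

lemma entries_measurable_mult:
  fixes E F :: "'a \<Rightarrow> real mat"
  assumes "entries_measurable N r c E" "entries_measurable N c d F"
  shows "entries_measurable N r d (\<lambda>x. E x * F x)"
  unfolding entries_measurable_def
proof (intro conjI ballI allI impI)
  fix i j assume ij: "i < r" "j < d"
  have "(\<lambda>x. \<Sum>k<c. E x $$ (i, k) * F x $$ (k, j)) \<in> borel_measurable N"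
    using assms ij by (intro borel_measurable_sum borel_measurable_times) (auto simp: entries_measurable_def)
  also have "?this \<longleftrightarrow> (\<lambda>x. (E x * F x) $$ (i, j)) \<in> borel_measurable N"
    by (rule measurable_cong)
      (use assms ij in \<open>fastforce simp: entries_measurable_def scalar_prod_def atLeast0LessThan\<close>)
  finally show "(\<lambda>x. (E x * F x) $$ (i, j)) \<in> borel_measurable N" .
qed (use assms in \<open>auto simp: entries_measurable_def\<close>)

section \<open>Coefficientwise measurability of random polynomials\<close>

definition poly_measurable :: "'a measure \<Rightarrow> ('a \<Rightarrow> real poly) \<Rightarrow> bool" where
  "poly_measurable N p \<longleftrightarrow> (\<forall>k. (\<lambda>x. coeff (p x) k) \<in> borel_measurable N)"

lemma poly_measurable_const: "poly_measurable N (\<lambda>_. p)"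
  by (simp add: poly_measurable_def)

lemma poly_measurable_pCons:
  "f \<in> borel_measurable N \<Longrightarrow> poly_measurable N p \<Longrightarrow> poly_measurable N (\<lambda>x. pCons (f x) (p x))"
  unfolding poly_measurable_def coeff_pCons
proof
  fix k assume "f \<in> borel_measurable N" "\<forall>k. (\<lambda>x. coeff (p x) k) \<in> borel_measurable N"
  then show "(\<lambda>x. case k of 0 \<Rightarrow> f x | Suc j \<Rightarrow> coeff (p x) j) \<in> borel_measurable N"
    by (cases k) simp_all
qed

lemma poly_measurable_mult:
  "poly_measurable N p \<Longrightarrow> poly_measurable N q \<Longrightarrow> poly_measurable N (\<lambda>x. p x * q x)"
  unfolding poly_measurable_def coeff_mult
  by (intro allI borel_measurable_sum borel_measurable_times) auto

lemma poly_measurable_add: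
  "poly_measurable N p \<Longrightarrow> poly_measurable N q \<Longrightarrow> poly_measurable N (\<lambda>x. p x + q x)"
  unfolding poly_measurable_def coeff_add by (intro allI borel_measurable_add) auto

lemma poly_measurable_prod:
  "(\<And>i. i \<in> I \<Longrightarrow> poly_measurable N (p i)) \<Longrightarrow> poly_measurable N (\<lambda>x. \<Prod>i\<in>I. p i x)"
  by (induction I rule: infinite_finite_induct)
    (auto intro: poly_measurable_mult poly_measurable_const)

lemma poly_measurable_sum:
  "(\<And>i. i \<in> I \<Longrightarrow> poly_measurable N (p i)) \<Longrightarrow> poly_measurable N (\<lambda>x. \<Sum>i\<in>I. p i x)"
  by (induction I rule: infinite_finite_induct)
    (auto intro: poly_measurable_add poly_measurable_const)

lemma poly_measurable_cong:
  "(\<And>x. x \<in> space N \<Longrightarrow> p x = q x) \<Longrightarrow> poly_measurable N p \<longleftrightarrow> poly_measurable N q"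
  unfolding poly_measurable_def by (intro all_cong1 measurable_cong) simp

text \<open>The Leibniz formula uses only finite sums and products, whose coefficients are finite
  convolutions.\<close>

lemma poly_measurable_det:
  assumes car: "\<And>x. x \<in> space N \<Longrightarrow> F x \<in> carrier_mat n n"
    and F: "\<And>i j. i < n \<Longrightarrow> j < n \<Longrightarrow> poly_measurable N (\<lambda>x. F x $$ (i, j))"
  shows "poly_measurable N (\<lambda>x. det (F x))"
proof -
  have "poly_measurable N (\<lambda>x. \<Sum>p\<in>{p. p permutes {0..<n}}. signof p * (\<Prod>i = 0..<n. F x $$ (i, p i)))"
    by (intro poly_measurable_sum poly_measurable_mult poly_measurable_prod F poly_measurable_const)
      (auto dest: permutes_in_image)
  also have "?this \<longleftrightarrow> ?thesis"
    by (rule poly_measurable_cong) (simp add: det_def'[OF car])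
  finally show ?thesis .
qed

lemma poly_measurable_char_poly_matrix:
  assumes F: "entries_measurable N n n F" and ij: "i < n" "j < n"
  shows "poly_measurable N (\<lambda>x. char_poly_matrix (F x) $$ (i, j))"
proof -
  have "poly_measurable N (\<lambda>x. [:0, 1:] * (if i = j then 1 else 0) + [:- (F x $$ (i, j)):])"
    using F ij by (intro poly_measurable_add poly_measurable_const poly_measurable_pCons)
      (auto simp: entries_measurable_def)
  also have "?this \<longleftrightarrow> ?thesis"
    by (rule poly_measurable_cong) (use F ij in \<open>auto simp: entries_measurable_def char_poly_matrix_def\<close>)
  finally show ?thesis .
qed

lemma entries_measurable_adj_coeff:
  assumes F: "entries_measurable N n n F"
  shows "entries_measurable N n n (\<lambda>x. adj_coeff k (F x))"
  unfolding entries_measurable_def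
proof (intro conjI ballI allI impI)
  fix x assume "x \<in> space N"
  then show "adj_coeff k (F x) \<in> carrier_mat n n"
    using F by (intro adj_coeff_carrier) (auto simp: entries_measurable_def)
next
  fix i j assume ij: "i < n" "j < n"
  have car: "F x \<in> carrier_mat n n" if "x \<in> space N" for x
    using F that by (auto simp: entries_measurable_def)
  let ?C = "\<lambda>x. char_poly_matrix (F x)"
  have Ccar: "?C x \<in> carrier_mat n n" if "x \<in> space N" for x
    by (rule char_poly_matrix_closed[OF car[OF that]])
  \<comment> \<open>The adjugate is the transposed cofactor matrix, hence the exchanged
    indices.\<close>
  have "poly_measurable N (\<lambda>x. (- 1) ^ (j + i) * det (mat_delete (?C x) j i))"
  proof (intro poly_measurable_mult poly_measurable_const poly_measurable_det[where n = "n - 1"])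
    fix x assume "x \<in> space N"
    then show "mat_delete (?C x) j i \<in> carrier_mat (n - 1) (n - 1)"
      using carrier_matD[OF Ccar] by (auto simp: mat_delete_def)
  next
    fix a b assume ab: "a < n - 1" "b < n - 1"
    have "poly_measurable N (\<lambda>x. ?C x $$ (if a < j then a else Suc a, if b < i then b else Suc b))"
      by (rule poly_measurable_char_poly_matrix[OF F]) (use ab in auto)
    also have "?this \<longleftrightarrow> poly_measurable N (\<lambda>x. mat_delete (?C x) j i $$ (a, b))"
      by (rule poly_measurable_cong) (use ab carrier_matD[OF Ccar] in \<open>auto simp: mat_delete_def\<close>)
    finally show "poly_measurable N (\<lambda>x. mat_delete (?C x) j i $$ (a, b))" .
  qed
  then have "(\<lambda>x. coeff ((- 1) ^ (j + i) * det (mat_delete (?C x) j i)) k) \<in> borel_measurable N"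
    by (simp add: poly_measurable_def)
  also have "?this \<longleftrightarrow> (\<lambda>x. adj_coeff k (F x) $$ (i, j)) \<in> borel_measurable N"
  proof (rule measurable_cong)
    fix x assume "x \<in> space N"
    with carrier_matD[OF Ccar[OF this]] ij
    show "coeff ((- 1) ^ (j + i) * det (mat_delete (?C x) j i)) k = adj_coeff k (F x) $$ (i, j)"
      by (simp add: adj_coeff_def adj_mat_def cofactor_def)
  qed
  finally show "(\<lambda>x. adj_coeff k (F x) $$ (i, j)) \<in> borel_measurable N" .
qed

lemma measurable_coeff_char_poly:
  fixes F :: "'a \<Rightarrow> real mat"
  assumes F: "entries_measurable N n n F"
  shows "(\<lambda>x. coeff (char_poly (F x)) k) \<in> borel_measurable N"
proof -
  have "poly_measurable N (\<lambda>x. char_poly (F x))"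
    unfolding char_poly_def
    by (rule poly_measurable_det[where n = n])
      (use F in \<open>auto simp: entries_measurable_def poly_measurable_char_poly_matrix[OF F]\<close>)
  then show ?thesis by (simp add: poly_measurable_def)
qed

text \<open>The index \<open>char_order\<close> depends on the sample, but it is a measurable
  natural number; for each fixed value the formula is a quotient of measurable functions, and
  countably many cases are glued.\<close>

lemma entries_measurable_group_inv:
  assumes F: "entries_measurable N n n F"
  shows "entries_measurable N n n (\<lambda>x. group_inv (F x))"
  unfolding entries_measurable_def
proof (intro conjI ballI allI impI)
  fix x assume "x \<in> space N"
  then show "group_inv (F x) \<in> carrier_mat n n"
    using F adj_coeff_carrier[of "F x" n] by (auto simp: group_inv_def entries_measurable_def)
next
  fix i j assume ij: "i < n" "j < n"
  note [measurable] = measurable_coeff_char_poly[OF F]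
  have [measurable]: "(\<lambda>x. adj_coeff k (F x) $$ (i, j)) \<in> borel_measurable N" for k
    using entries_measurable_adj_coeff[OF F, of k] ij by (auto simp: entries_measurable_def)
  have [measurable]: "(\<lambda>x. char_order (F x)) \<in> measurable N (count_space UNIV)"
    unfolding char_order_def by measurable
  have "(\<lambda>x. (- 1 / coeff (char_poly (F x)) (char_order (F x))) * adj_coeff (char_order (F x)) (F x) $$ (i, j))
      \<in> borel_measurable N"
    by (rule measurable_compose_countable[where g = "\<lambda>x. char_order (F x)"
        and f = "\<lambda>k x. (- 1 / coeff (char_poly (F x)) k) * adj_coeff k (F x) $$ (i, j)"]) measurable
  also have "?this \<longleftrightarrow> (\<lambda>x. group_inv (F x) $$ (i, j)) \<in> borel_measurable N"
  proof (rule measurable_cong)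
    fix x assume "x \<in> space N"
    then have "F x \<in> carrier_mat n n" using F by (auto simp: entries_measurable_def)
    from carrier_matD[OF adj_coeff_carrier[OF this, of "char_order (F x)"]] ij
    show "(- 1 / coeff (char_poly (F x)) (char_order (F x))) * adj_coeff (char_order (F x)) (F x) $$ (i, j) =
      group_inv (F x) $$ (i, j)"
      by (simp add: group_inv_def)
  qed
  finally show "(\<lambda>x. group_inv (F x) $$ (i, j)) \<in> borel_measurable N" .
qed

lemma entries_measurable_pinv:
  assumes F: "entries_measurable N n n F" and sym: "\<And>x. x \<in> space N \<Longrightarrow> transpose_mat (F x) = F x"
  shows "entries_measurable N n n (\<lambda>x. pinv (F x))"
proof -
  have car: "F x \<in> carrier_mat n n" if "x \<in> space N" for x
    using F that by (auto simp: entries_measurable_def)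
  have "entries_measurable N n n (\<lambda>x. group_inv (F x) * F x * group_inv (F x))"
    by (intro entries_measurable_mult[where c = n] entries_measurable_group_inv F)
  then show ?thesis
    unfolding entries_measurable_def
    by (auto simp: pinv_symmetric(2)[OF car sym] cong: measurable_cong)
qed

section \<open>Sketches with a random number of columns\<close>

lemma space_mat_algebra: "space (mat_algebra r) = {Q. dim_row Q = r}"
  unfolding mat_algebra_def by (intro space_measure_of) auto

lemma sets_mat_algebraI:
  "Q \<in> {carrier_mat r c | c. True} \<union>
      {{Q \<in> carrier_mat r c. Q $$ (i, j) \<in> U} | c i j U. i < r \<and> j < c \<and> open U} \<Longrightarrow>
   Q \<in> sets (mat_algebra r)"
  unfolding mat_algebra_def by (subst sets_measure_of) (auto intro: sigma_sets.Basic)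

lemma entries_measurable_id:
  "entries_measurable (restrict_space (mat_algebra r) (carrier_mat r c)) r c (\<lambda>Q. Q)"
  unfolding entries_measurable_def
proof (intro conjI ballI allI impI borel_measurableI)
  have C: "carrier_mat r c \<in> sets (mat_algebra r)" by (rule sets_mat_algebraI) auto
  have C': "carrier_mat r c \<inter> space (mat_algebra r) = carrier_mat r c" by (auto simp: space_mat_algebra)
  fix i j and U :: "real set" assume ij: "i < r" "j < c" "open U"
  have "{Q \<in> carrier_mat r c. Q $$ (i, j) \<in> U} \<in> sets (mat_algebra r)"
    by (rule sets_mat_algebraI) (use ij in blast)
  moreover have "(\<lambda>Q. Q $$ (i, j)) -` U \<inter> space (restrict_space (mat_algebra r) (carrier_mat r c)) =
      {Q \<in> carrier_mat r c. Q $$ (i, j) \<in> U}"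
    by (auto simp: space_restrict_space space_mat_algebra)
  ultimately show "(\<lambda>Q. Q $$ (i, j)) -` U \<inter> space (restrict_space (mat_algebra r) (carrier_mat r c))
      \<in> sets (restrict_space (mat_algebra r) (carrier_mat r c))"
    using C C' by (subst sets_restrict_space_iff) auto
qed (auto simp: space_restrict_space)

lemma Z1'_measurable:
  assumes G: "symmetric_pos_def m G" and A: "A \<in> carrier_mat p m"
  shows "entries_measurable (mat_algebra p) m m (Z1' G A)"
  unfolding entries_measurable_def
proof (intro conjI ballI allI impI)
  fix S assume "S \<in> space (mat_algebra p)"
  then show "Z1' G A S \<in> carrier_mat m m"
    by (intro Z1'_projection(1)[OF G A, of S "dim_col S"]) (auto simp: space_mat_algebra)
next
  fix i j assume ij: "i < m" "j < m"
  show "(\<lambda>S. Z1' G A S $$ (i, j)) \<in> borel_measurable (mat_algebra p)"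
  \<comment> \<open>One piece per number of columns: there are countably many, each is a generator
    of the sigma-algebra, and on each the Gram matrix has a fixed size.\<close>
  proof (rule measurable_piecewise_restrict[where C = "range (carrier_mat p)"])
    fix W :: "real mat set" assume "W \<in> range (carrier_mat p)"
    then obtain c where W: "W = carrier_mat p c" by blast
    have "carrier_mat p c \<in> sets (mat_algebra p)" by (rule sets_mat_algebraI) auto
    then show "W \<inter> space (mat_algebra p) \<in> sets (mat_algebra p)" unfolding W by auto
    let ?N = "restrict_space (mat_algebra p) (carrier_mat p c)"
    note I = inv_mat_symmetric_pos_def[OF G]
    have Sm: "entries_measurable ?N p c (\<lambda>S. S)" by (rule entries_measurable_id)
    have St: "entries_measurable ?N c p (\<lambda>S. transpose_mat S)" by (rule entries_measurable_transpose[OF Sm])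
    have Im: "entries_measurable ?N m m (\<lambda>_. inv_mat G)" and Am: "entries_measurable ?N p m (\<lambda>_. A)"
      and At: "entries_measurable ?N m p (\<lambda>_. transpose_mat A)"
      using I A by (auto intro: entries_measurable_const)
    note mult = entries_measurable_mult
    have "entries_measurable ?N c c (\<lambda>S. transpose_mat S * A * inv_mat G * transpose_mat A * S)"
      by (rule mult mult[OF mult] St Sm Im Am At mult[OF mult[OF mult[OF mult[OF St Am] Im] At] Sm])+
    then have Y: "entries_measurable ?N c c (\<lambda>S. pinv (transpose_mat S * A * inv_mat G * transpose_mat A * S))"
      by (rule entries_measurable_pinv)
        (auto simp: space_restrict_space intro!: sketch_gram_symmetric(2)[OF G A])
    have "entries_measurable ?N m m (Z1' G A)"
      unfolding Z1'_def[abs_def]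
      by (rule mult[OF mult[OF mult[OF mult[OF mult[OF Im At] Sm] Y] St] Am])
    then show "(\<lambda>S. Z1' G A S $$ (i, j)) \<in> borel_measurable (restrict_space (mat_algebra p) W)"
      using ij unfolding W by (auto simp: entries_measurable_def)
  qed (auto simp: space_mat_algebra)
qed

lemma Z2_measurable:
  assumes B: "B \<in> carrier_mat n q"
  shows "entries_measurable (mat_algebra q) n n (Z2 B)"
proof -
  have "entries_measurable (mat_algebra q) n n (Z1' (1\<^sub>m n) (transpose_mat B))"
    using B by (intro Z1'_measurable symmetric_pos_def_one) auto
  moreover have "Z2 B P = Z1' (1\<^sub>m n) (transpose_mat B) P" if "P \<in> space (mat_algebra q)" for P
    using that by (intro Z2_eq_Z1'[OF B, of P "dim_col P"]) (auto simp: space_mat_algebra)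
  ultimately show ?thesis
    unfolding entries_measurable_def by (auto cong: measurable_cong)
qed

section \<open>Independent random projections\<close>

text \<open>Driven by a plain sequence of samples and not by random variables: the iterate after
  \<open>k\<close> steps is a deterministic function of the first \<open>k\<close> samples, to which
  independence of sample blocks can be applied.\<close>

primrec proj_iter :: "('b \<Rightarrow> real mat) \<Rightarrow> real Matrix.vec \<Rightarrow> (nat \<Rightarrow> 'b) \<Rightarrow> nat \<Rightarrow> real Matrix.vec" where
  "proj_iter K v f 0 = v"
| "proj_iter K v f (Suc k) = proj_iter K v f k - K (f k) *\<^sub>v proj_iter K v f k"

locale weighted_projection =
  fixes d :: nat and H K :: "real mat"
  assumes H: "symmetric_pos_def d H" and K: "K \<in> carrier_mat d d"
    and idem: "K * K = K" and sym: "transpose_mat (H * K) = H * K"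
begin

lemma H_carrier: "H \<in> carrier_mat d d" and H_sym: "transpose_mat H = H"
  using H by (auto simp: symmetric_pos_def_def)

lemma proj_energy:
  assumes w: "w \<in> carrier_vec d"
  shows "scalar_prod (K *\<^sub>v w) (H *\<^sub>v (K *\<^sub>v w)) = scalar_prod w ((H * K) *\<^sub>v w)"
proof -
  have Kw: "K *\<^sub>v w \<in> carrier_vec d" using K w by simp
  have HK: "H * K \<in> carrier_mat d d" using H_carrier K by simp
  have "scalar_prod (K *\<^sub>v w) (H *\<^sub>v (K *\<^sub>v w)) = scalar_prod (K *\<^sub>v w) ((H * K) *\<^sub>v w)"
    using H_carrier K w by simp
  also have "\<dots> = scalar_prod w ((H * K) *\<^sub>v (K *\<^sub>v w))"
    by (rule scalar_prod_symmetric_mat[OF HK sym Kw w])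
  also have "(H * K) *\<^sub>v (K *\<^sub>v w) = (H * K * K) *\<^sub>v w"
    by (rule assoc_mult_mat_vec[OF HK K w, symmetric])
  also have "H * K * K = H * (K * K)" by (rule assoc_mult_mat[OF H_carrier K K])
  finally show ?thesis unfolding idem .
qed

text \<open>Pythagoras for an \<open>H\<close>-orthogonal projection: both cross terms and the
  energy of the projected part equal the same form of \<open>H * K\<close>, so exactly one copy of
  it is subtracted.\<close>

lemma complement_energy:
  assumes w: "w \<in> carrier_vec d"
  shows "scalar_prod (w - K *\<^sub>v w) (H *\<^sub>v (w - K *\<^sub>v w)) =
    scalar_prod w (H *\<^sub>v w) - scalar_prod w ((H * K) *\<^sub>v w)"
proof -
  define u where "u = K *\<^sub>v w"
  have u: "u \<in> carrier_vec d" using K w by (simp add: u_def)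
  have Hw: "H *\<^sub>v w \<in> carrier_vec d" and Hu: "H *\<^sub>v u \<in> carrier_vec d" using H_carrier w u by auto
  have wHu: "scalar_prod w (H *\<^sub>v u) = scalar_prod w ((H * K) *\<^sub>v w)"
    using H_carrier K w by (simp add: u_def)
  have uHw: "scalar_prod u (H *\<^sub>v w) = scalar_prod w (H *\<^sub>v u)"
    by (rule scalar_prod_symmetric_mat[OF H_carrier H_sym u w])
  have "scalar_prod (w - u) (H *\<^sub>v (w - u)) = scalar_prod (w - u) (H *\<^sub>v w - H *\<^sub>v u)"
    by (simp add: mult_minus_distrib_mat_vec[OF H_carrier w u])
  also have "\<dots> = scalar_prod w (H *\<^sub>v w) - scalar_prod w (H *\<^sub>v u)
      - (scalar_prod u (H *\<^sub>v w) - scalar_prod u (H *\<^sub>v u))"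
    using w u Hw Hu
    by (simp add: minus_scalar_prod_distrib[of _ d] scalar_prod_minus_distrib[of _ d])
  also have "\<dots> = scalar_prod w (H *\<^sub>v w) - scalar_prod w ((H * K) *\<^sub>v w)"
    using wHu uHw proj_energy[OF w] by (simp add: u_def)
  finally show ?thesis unfolding u_def .
qed

text \<open>This bound and the next one express the nonnegative energies of the two components of
  \<open>w\<close>. This one makes the energy decrease along every path; the next one bounds the
  entries of \<open>K\<close> and the smallest eigenvalue of its mean.\<close>

lemma proj_form_nonneg: "w \<in> carrier_vec d \<Longrightarrow> 0 \<le> scalar_prod w ((H * K) *\<^sub>v w)"
  using symmetric_pos_def_nonneg[OF H, of "K *\<^sub>v w"] K by (simp add: proj_energy)

lemma proj_form_le: "w \<in> carrier_vec d \<Longrightarrow> scalar_prod w ((H * K) *\<^sub>v w) \<le> scalar_prod w (H *\<^sub>v w)"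
  using symmetric_pos_def_nonneg[OF H, of "w - K *\<^sub>v w"] K by (simp add: complement_energy)

end

lemma square_le_scalar_prod:
  fixes v :: "real Matrix.vec"
  assumes "v \<in> carrier_vec d" "i < d"
  shows "(v $ i)\<^sup>2 \<le> scalar_prod v v"
  using member_le_sum[of i "{..<d}" "\<lambda>i. (v $ i)\<^sup>2"] assms
  by (simp add: scalar_prod_def atLeast0LessThan power2_eq_square)

text \<open>Coercivity of \<open>H\<close>; the constant \<open>b\<close> is fixed before vector and
  index, so the bound is uniform over samples.\<close>

lemma energy_bounds_entry:
  assumes H: "symmetric_pos_def d H"
  obtains b where "\<And>w i e. w \<in> carrier_vec d \<Longrightarrow> i < d \<Longrightarrow> scalar_prod w (H *\<^sub>v w) \<le> e \<Longrightarrow> \<bar>w $ i\<bar> \<le> sqrt (b * e)"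
proof -
  obtain c where c: "c > 0" "\<And>w. w \<in> carrier_vec d \<Longrightarrow> c * scalar_prod w w \<le> scalar_prod w (H *\<^sub>v w)"
    using symmetric_pos_def_coercive[OF H] by blast
  have "\<bar>w $ i\<bar> \<le> sqrt (1 / c * e)"
    if w: "w \<in> carrier_vec d" "i < d" "scalar_prod w (H *\<^sub>v w) \<le> e" for w i e
  proof (rule real_le_rsqrt)
    have "c * (w $ i)\<^sup>2 \<le> c * scalar_prod w w"
      using c(1) square_le_scalar_prod[OF w(1,2)] by simp
    also have "\<dots> \<le> e" using c(2)[OF w(1)] w(3) by simp
    finally show "\<bar>w $ i\<bar>\<^sup>2 \<le> 1 / c * e" using c(1) by (simp add: field_simps)
  qed
  then show thesis by (rule that)
qed

lemma integral_double_sum: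
  fixes f :: "'i \<Rightarrow> 'j \<Rightarrow> 'a \<Rightarrow> real"
  assumes "\<And>i j. i \<in> I \<Longrightarrow> j \<in> J \<Longrightarrow> integrable M (f i j)"
  shows "(\<integral>x. (\<Sum>i\<in>I. \<Sum>j\<in>J. f i j x) \<partial>M) = (\<Sum>i\<in>I. \<Sum>j\<in>J. \<integral>x. f i j x \<partial>M)"
proof -
  have "(\<integral>x. (\<Sum>i\<in>I. \<Sum>j\<in>J. f i j x) \<partial>M) = (\<Sum>i\<in>I. \<integral>x. (\<Sum>j\<in>J. f i j x) \<partial>M)"
    by (intro Bochner_Integration.integral_sum Bochner_Integration.integrable_sum assms)
  also have "\<dots> = (\<Sum>i\<in>I. \<Sum>j\<in>J. \<integral>x. f i j x \<partial>M)"
    by (intro sum.cong refl Bochner_Integration.integral_sum assms)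
  finally show ?thesis .
qed

text \<open>The purely probabilistic core: independent samples of law \<open>D\<close> in an
  arbitrary space, each giving an \<open>H\<close>-orthogonal projection. The origin of
  \<open>K\<close> in sketches enters only at the interpretation.\<close>

locale iid_projections = prob_space M for M :: "'a measure" +
  fixes N D :: "'b measure" and K :: "'b \<Rightarrow> real mat" and R :: "nat \<Rightarrow> 'a \<Rightarrow> 'b"
    and d :: nat and H :: "real mat" and v0 :: "real Matrix.vec"
  assumes d: "0 < d" and H: "symmetric_pos_def d H" and v0: "v0 \<in> carrier_vec d"
    and K_measurable: "entries_measurable N d d K"
    and K_idem: "\<And>x. x \<in> space N \<Longrightarrow> K x * K x = K x"
    and K_sym: "\<And>x. x \<in> space N \<Longrightarrow> transpose_mat (H * K x) = H * K x"
    and R_indep: "indep_vars (\<lambda>_. N) R UNIV"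
    and R_distr: "\<And>k. distr M N (R k) = D"
begin

abbreviation EK :: "real mat" where "EK \<equiv> mat_expectation d d D K"

abbreviation iterate :: "nat \<Rightarrow> 'a \<Rightarrow> real Matrix.vec" where
  "iterate k \<omega> \<equiv> proj_iter K v0 (\<lambda>i. R i \<omega>) k"

lemma H_carrier: "H \<in> carrier_mat d d"
  using H by (auto simp: symmetric_pos_def_def)

lemma R_measurable [measurable]: "R k \<in> measurable M N"
  using R_indep by (auto simp: indep_vars_def)

lemma R_space: "\<omega> \<in> space M \<Longrightarrow> R k \<omega> \<in> space N"
  by (rule measurable_space[OF R_measurable])

lemma K_carrier: "x \<in> space N \<Longrightarrow> K x \<in> carrier_mat d d"
  using K_measurable by (auto simp: entries_measurable_def)

lemma projection: "x \<in> space N \<Longrightarrow> weighted_projection d H (K x)"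
  using H K_carrier K_idem K_sym by (simp add: weighted_projection_def)

lemma proj_iter_carrier: "(\<And>i. i < k \<Longrightarrow> f i \<in> space N) \<Longrightarrow> proj_iter K v0 f k \<in> carrier_vec d"
proof (induction k)
  case (Suc k)
  then show ?case using K_carrier[of "f k"] by simp
qed (simp add: v0)

lemma iterate_carrier: "\<omega> \<in> space M \<Longrightarrow> iterate k \<omega> \<in> carrier_vec d"
  by (rule proj_iter_carrier) (rule R_space)

lemma iterate_energy_le:
  "\<omega> \<in> space M \<Longrightarrow> scalar_prod (iterate k \<omega>) (H *\<^sub>v iterate k \<omega>) \<le> scalar_prod v0 (H *\<^sub>v v0)"
proof (induction k)
  case (Suc k)
  interpret weighted_projection d H "K (R k \<omega>)" by (rule projection[OF R_space[OF Suc.prems]])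
  show ?case
    using Suc complement_energy[OF iterate_carrier[OF Suc.prems]]
      proj_form_nonneg[OF iterate_carrier[OF Suc.prems]] by (smt (verit) proj_iter.simps(2))
qed simp

lemma iterate_bounded:
  obtains b where "\<And>k \<omega> i. \<omega> \<in> space M \<Longrightarrow> i < d \<Longrightarrow> \<bar>iterate k \<omega> $ i\<bar> \<le> b"
proof -
  obtain b where "\<And>w i e. w \<in> carrier_vec d \<Longrightarrow> i < d \<Longrightarrow> scalar_prod w (H *\<^sub>v w) \<le> e \<Longrightarrow> \<bar>w $ i\<bar> \<le> sqrt (b * e)"
    using energy_bounds_entry[OF H] by blast
  from that[OF this[OF iterate_carrier _ iterate_energy_le]] show thesis .
qed

lemma K_bounded:
  obtains b where "\<And>x i j. x \<in> space N \<Longrightarrow> i < d \<Longrightarrow> j < d \<Longrightarrow> \<bar>K x $$ (i, j)\<bar> \<le> b"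
proof -
  obtain b where b: "\<And>w i e. w \<in> carrier_vec d \<Longrightarrow> i < d \<Longrightarrow> scalar_prod w (H *\<^sub>v w) \<le> e \<Longrightarrow> \<bar>w $ i\<bar> \<le> sqrt (b * e)"
    using energy_bounds_entry[OF H] by blast
  define h where "h = (\<lambda>j. scalar_prod (unit_vec d j) (H *\<^sub>v unit_vec d j))"
  \<comment> \<open>Column \<open>j\<close> of \<open>K\<close> is the projection of a unit vector,
    so its energy is at most that of the unit vector. Summing over all columns gives one bound for
    every \<open>j\<close>.\<close>
  have "\<bar>K x $$ (i, j)\<bar> \<le> (\<Sum>j<d. \<bar>sqrt (b * h j)\<bar>)" if x: "x \<in> space N" and ij: "i < d" "j < d" for x i j
  proof -
    interpret weighted_projection d H "K x" by (rule projection[OF x])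
    have "K x *\<^sub>v unit_vec d j = col (K x) j"
      using K ij by (intro eq_vecI) auto
    moreover have "\<bar>(K x *\<^sub>v unit_vec d j) $ i\<bar> \<le> sqrt (b * h j)"
      using K ij proj_form_le[of "unit_vec d j"] by (intro b) (auto simp: h_def proj_energy)
    ultimately have "\<bar>K x $$ (i, j)\<bar> \<le> \<bar>sqrt (b * h j)\<bar>" using K ij by simp
    also have "\<dots> \<le> (\<Sum>j<d. \<bar>sqrt (b * h j)\<bar>)" using ij by (intro member_le_sum) auto
    finally show ?thesis .
  qed
  then show thesis by (rule that)
qed

lemma K_entry_measurable: "i < d \<Longrightarrow> j < d \<Longrightarrow> (\<lambda>x. K x $$ (i, j)) \<in> borel_measurable N"
  using K_measurable by (auto simp: entries_measurable_def)

lemma HK_entry_measurable: "i < d \<Longrightarrow> j < d \<Longrightarrow> (\<lambda>x. (H * K x) $$ (i, j)) \<in> borel_measurable N"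
  using entries_measurable_mult[OF entries_measurable_const[OF H_carrier] K_measurable]
  by (auto simp: entries_measurable_def)

lemma HK_entry: "x \<in> space N \<Longrightarrow> i < d \<Longrightarrow> j < d \<Longrightarrow> (H * K x) $$ (i, j) = (\<Sum>l<d. H $$ (i, l) * K x $$ (l, j))"
  using H_carrier K_carrier[of x] by (simp add: scalar_prod_def atLeast0LessThan)

lemma K_entry_integrable:
  assumes "i < d" "j < d"
  shows "integrable M (\<lambda>\<omega>. K (R k \<omega>) $$ (i, j))"
proof -
  obtain b where "\<And>x i j. x \<in> space N \<Longrightarrow> i < d \<Longrightarrow> j < d \<Longrightarrow> \<bar>K x $$ (i, j)\<bar> \<le> b"
    using K_bounded by blast
  then show ?thesis
    using assms R_space measurable_compose[OF R_measurable K_entry_measurable[OF assms]]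
    by (intro integrable_const_bound[of _ b]) auto
qed

lemma HK_entry_integrable:
  assumes "i < d" "j < d"
  shows "integrable M (\<lambda>\<omega>. (H * K (R k \<omega>)) $$ (i, j))"
proof -
  have "integrable M (\<lambda>\<omega>. \<Sum>l<d. H $$ (i, l) * K (R k \<omega>) $$ (l, j))"
    using assms by (intro Bochner_Integration.integrable_sum integrable_mult_right K_entry_integrable) auto
  also have "?this \<longleftrightarrow> ?thesis"
    by (rule Bochner_Integration.integrable_cong) (use assms HK_entry R_space in auto)
  finally show ?thesis .
qed

lemma expectation_HK:
  assumes "i < d" "j < d"
  shows "expectation (\<lambda>\<omega>. (H * K (R k \<omega>)) $$ (i, j)) = (H * EK) $$ (i, j)"
proof -
  have "expectation (\<lambda>\<omega>. (H * K (R k \<omega>)) $$ (i, j)) =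
      expectation (\<lambda>\<omega>. \<Sum>l<d. H $$ (i, l) * K (R k \<omega>) $$ (l, j))"
    by (rule Bochner_Integration.integral_cong) (use assms HK_entry R_space in auto)
  also have "\<dots> = (\<Sum>l<d. H $$ (i, l) * expectation (\<lambda>\<omega>. K (R k \<omega>) $$ (l, j)))"
    using assms K_entry_integrable by (subst Bochner_Integration.integral_sum) auto
  also have "\<dots> = (\<Sum>l<d. H $$ (i, l) * EK $$ (l, j))"
  proof (rule sum.cong[OF refl])
    fix l assume "l \<in> {..<d}"
    then have "expectation (\<lambda>\<omega>. K (R k \<omega>) $$ (l, j)) = EK $$ (l, j)"
      using assms integral_distr[OF R_measurable[of k] K_entry_measurable[of l j]]
      by (simp add: R_distr mat_expectation_def)
    then show "H $$ (i, l) * expectation (\<lambda>\<omega>. K (R k \<omega>) $$ (l, j)) = H $$ (i, l) * EK $$ (l, j)" by simp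
  qed
  also have "\<dots> = (H * EK) $$ (i, j)"
    using H_carrier assms by (simp add: scalar_prod_def atLeast0LessThan mat_expectation_def)
  finally show ?thesis .
qed

lemma EK_carrier: "EK \<in> carrier_mat d d"
  by (simp add: mat_expectation_def)

text \<open>Symmetry passes to the mean entry by entry; sample 0 serves as a representative of the
  law \<open>D\<close>.\<close>

lemma HEK_sym: "transpose_mat (H * EK) = H * EK"
proof (rule eq_matI)
  fix i j assume "i < dim_row (H * EK)" "j < dim_col (H * EK)"
  then have ij: "i < d" "j < d" using H_carrier EK_carrier by auto
  have "(H * EK) $$ (j, i) = expectation (\<lambda>\<omega>. (H * K (R 0 \<omega>)) $$ (j, i))"
    using expectation_HK ij by simp
  also have "\<dots> = expectation (\<lambda>\<omega>. (H * K (R 0 \<omega>)) $$ (i, j))"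
  proof (rule Bochner_Integration.integral_cong[OF refl])
    fix \<omega> assume "\<omega> \<in> space M"
    then have x: "R 0 \<omega> \<in> space N" by (rule R_space)
    have "H * K (R 0 \<omega>) \<in> carrier_mat d d" using H_carrier K_carrier[OF x] by simp
    then have "transpose_mat (H * K (R 0 \<omega>)) $$ (i, j) = (H * K (R 0 \<omega>)) $$ (j, i)"
      using ij by (intro index_transpose_mat(1)) auto
    then show "(H * K (R 0 \<omega>)) $$ (j, i) = (H * K (R 0 \<omega>)) $$ (i, j)"
      by (simp only: K_sym[OF x])
  qed
  also have "\<dots> = (H * EK) $$ (i, j)" using expectation_HK ij by simp
  finally show "transpose_mat (H * EK) $$ (i, j) = (H * EK) $$ (i, j)"
    using ij H_carrier EK_carrier by simp
qed (use H_carrier EK_carrier in auto)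

text \<open>The index set \<open>J\<close> stays fixed while \<open>k\<close> drops in the
  induction, so it must be allowed to exceed the samples actually used.\<close>

lemma proj_iter_measurable:
  assumes "{..<k} \<subseteq> J" "i < d"
  shows "(\<lambda>f. proj_iter K v0 f k $ i) \<in> borel_measurable (PiM J (\<lambda>_. N))"
  using assms
proof (induction k arbitrary: i)
  case (Suc k)
  have "(\<lambda>f. proj_iter K v0 f k $ i - (\<Sum>j<d. K (f k) $$ (i, j) * proj_iter K v0 f k $ j))
      \<in> borel_measurable (PiM J (\<lambda>_. N))"
  proof (intro borel_measurable_diff borel_measurable_sum borel_measurable_times)
    have *: "{..<k} \<subseteq> J" using Suc.prems by auto
    show "(\<lambda>f. proj_iter K v0 f k $ i) \<in> borel_measurable (PiM J (\<lambda>_. N))" by (rule Suc.IH[OF * Suc.prems(2)])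
    fix j assume j: "j \<in> {..<d}"
    then show "(\<lambda>f. proj_iter K v0 f k $ j) \<in> borel_measurable (PiM J (\<lambda>_. N))" by (intro Suc.IH[OF *]) simp
    show "(\<lambda>f. K (f k) $$ (i, j)) \<in> borel_measurable (PiM J (\<lambda>_. N))"
      using Suc.prems j
      by (intro measurable_compose[OF _ K_entry_measurable] measurable_component_singleton) auto
  qed
  also have "?this \<longleftrightarrow> (\<lambda>f. proj_iter K v0 f (Suc k) $ i) \<in> borel_measurable (PiM J (\<lambda>_. N))"
  proof (rule measurable_cong)
    fix f assume "f \<in> space (PiM J (\<lambda>_. N))"
    then have f: "f i \<in> space N" if "i < Suc k" for i
      using Suc.prems that by (auto simp: space_PiM PiE_iff)
    have "proj_iter K v0 f k \<in> carrier_vec d" by (rule proj_iter_carrier) (use f in simp)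
    then show "proj_iter K v0 f k $ i - (\<Sum>j<d. K (f k) $$ (i, j) * proj_iter K v0 f k $ j) =
        proj_iter K v0 f (Suc k) $ i"
      using K_carrier[OF f[of k]] Suc.prems(2) by (simp add: scalar_prod_def atLeast0LessThan)
  qed
  finally show ?case .
qed simp

lemma proj_iter_cong: "(\<And>i. i < k \<Longrightarrow> f i = g i) \<Longrightarrow> proj_iter K v0 f k = proj_iter K v0 g k"
  by (induction k) auto

lemma iterate_measurable:
  assumes "i < d"
  shows "(\<lambda>\<omega>. iterate k \<omega> $ i) \<in> borel_measurable M"
proof -
  have "(\<lambda>\<omega>. \<lambda>i\<in>{..<k}. R i \<omega>) \<in> measurable M (PiM {..<k} (\<lambda>_. N))"
    by (intro measurable_restrict R_measurable)
  from measurable_compose[OF this proj_iter_measurable[OF order_refl assms]]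
  have "(\<lambda>\<omega>. proj_iter K v0 (\<lambda>i\<in>{..<k}. R i \<omega>) k $ i) \<in> borel_measurable M" .
  moreover have "proj_iter K v0 (\<lambda>i\<in>{..<k}. R i \<omega>) k = iterate k \<omega>" for \<omega>
    by (rule proj_iter_cong) simp
  ultimately show ?thesis by simp
qed

lemma iterate_product_integrable:
  assumes "i < d" "j < d"
  shows "integrable M (\<lambda>\<omega>. iterate k \<omega> $ i * iterate k \<omega> $ j)"
proof -
  obtain b where b: "\<And>k \<omega> i. \<omega> \<in> space M \<Longrightarrow> i < d \<Longrightarrow> \<bar>iterate k \<omega> $ i\<bar> \<le> b"
    using iterate_bounded by blast
  have "\<bar>iterate k \<omega> $ i * iterate k \<omega> $ j\<bar> \<le> b * b" if "\<omega> \<in> space M" for \<omega>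
    unfolding abs_mult using b[OF that assms(1), of k] b[OF that assms(2), of k] by (intro mult_mono) auto
  then show ?thesis
    using assms iterate_measurable
    by (intro integrable_const_bound[of _ "b * b"] borel_measurable_times) auto
qed

text \<open>The expected form depends on the iterate only through its second moments, which are
  finite by the pathwise bound.\<close>

lemma iterate_form_integrable:
  assumes T: "T \<in> carrier_mat d d"
  shows "integrable M (\<lambda>\<omega>. scalar_prod (iterate k \<omega>) (T *\<^sub>v iterate k \<omega>))"
    and "expectation (\<lambda>\<omega>. scalar_prod (iterate k \<omega>) (T *\<^sub>v iterate k \<omega>)) =
      (\<Sum>i<d. \<Sum>j<d. T $$ (i, j) * expectation (\<lambda>\<omega>. iterate k \<omega> $ i * iterate k \<omega> $ j))"
proof -
  have eq: "scalar_prod (iterate k \<omega>) (T *\<^sub>v iterate k \<omega>) =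
      (\<Sum>i<d. \<Sum>j<d. T $$ (i, j) * (iterate k \<omega> $ i * iterate k \<omega> $ j))" if "\<omega> \<in> space M" for \<omega>
    unfolding scalar_prod_mult_mat_vec[OF T iterate_carrier[OF that] iterate_carrier[OF that]]
    by (simp add: algebra_simps)
  have int: "integrable M (\<lambda>\<omega>. T $$ (i, j) * (iterate k \<omega> $ i * iterate k \<omega> $ j))" if "i < d" "j < d" for i j
    using that by (intro integrable_mult_right iterate_product_integrable)
  have "integrable M (\<lambda>\<omega>. \<Sum>i<d. \<Sum>j<d. T $$ (i, j) * (iterate k \<omega> $ i * iterate k \<omega> $ j))"
    by (intro Bochner_Integration.integrable_sum int) auto
  then show "integrable M (\<lambda>\<omega>. scalar_prod (iterate k \<omega>) (T *\<^sub>v iterate k \<omega>))"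
    by (subst Bochner_Integration.integrable_cong[OF refl eq])
  have "expectation (\<lambda>\<omega>. scalar_prod (iterate k \<omega>) (T *\<^sub>v iterate k \<omega>)) =
      expectation (\<lambda>\<omega>. \<Sum>i<d. \<Sum>j<d. T $$ (i, j) * (iterate k \<omega> $ i * iterate k \<omega> $ j))"
    by (rule Bochner_Integration.integral_cong[OF refl eq])
  also have "\<dots> = (\<Sum>i<d. \<Sum>j<d. expectation (\<lambda>\<omega>. T $$ (i, j) * (iterate k \<omega> $ i * iterate k \<omega> $ j)))"
    by (rule integral_double_sum, rule int) simp_all
  finally show "expectation (\<lambda>\<omega>. scalar_prod (iterate k \<omega>) (T *\<^sub>v iterate k \<omega>)) =
      (\<Sum>i<d. \<Sum>j<d. T $$ (i, j) * expectation (\<lambda>\<omega>. iterate k \<omega> $ i * iterate k \<omega> $ j))"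
    by simp
qed

text \<open>The iterate is a function of the samples with index below \<open>k\<close>, the matrix a
  function of sample \<open>k\<close>. These blocks are disjoint, so the expectation of the product
  factors.\<close>

lemma iterate_indep_K:
  assumes ij: "i < d" "j < d"
  shows "integrable M (\<lambda>\<omega>. iterate k \<omega> $ i * iterate k \<omega> $ j * (H * K (R k \<omega>)) $$ (i, j))"
    and "expectation (\<lambda>\<omega>. iterate k \<omega> $ i * iterate k \<omega> $ j * (H * K (R k \<omega>)) $$ (i, j)) =
      expectation (\<lambda>\<omega>. iterate k \<omega> $ i * iterate k \<omega> $ j) * (H * EK) $$ (i, j)"
proof -
  let ?Y1 = "\<lambda>f. proj_iter K v0 f k $ i * proj_iter K v0 f k $ j"
  let ?Y2 = "\<lambda>f :: nat \<Rightarrow> 'b. (H * K (f k)) $$ (i, j)"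
  have "indep_var (PiM {..<k} (\<lambda>_. N)) (\<lambda>\<omega>. \<lambda>i\<in>{..<k}. R i \<omega>) (PiM {k} (\<lambda>_. N)) (\<lambda>\<omega>. \<lambda>i\<in>{k}. R i \<omega>)"
    by (rule indep_var_restrict[OF R_indep]) auto
  moreover have "?Y1 \<in> borel_measurable (PiM {..<k} (\<lambda>_. N))"
    using ij by (intro borel_measurable_times proj_iter_measurable) auto
  moreover have "?Y2 \<in> borel_measurable (PiM {k} (\<lambda>_. N))"
    using ij by (intro measurable_compose[OF _ HK_entry_measurable] measurable_component_singleton) auto
  ultimately have "indep_var borel (?Y1 \<circ> (\<lambda>\<omega>. \<lambda>i\<in>{..<k}. R i \<omega>)) borel (?Y2 \<circ> (\<lambda>\<omega>. \<lambda>i\<in>{k}. R i \<omega>))"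
    by (rule indep_var_compose)
  moreover have "proj_iter K v0 (\<lambda>i\<in>{..<k}. R i \<omega>) k = iterate k \<omega>" for \<omega>
    by (rule proj_iter_cong) simp
  ultimately have "indep_var borel (\<lambda>\<omega>. iterate k \<omega> $ i * iterate k \<omega> $ j) borel (\<lambda>\<omega>. (H * K (R k \<omega>)) $$ (i, j))"
    by (simp add: comp_def)
  note indep = indep_var_integrable[OF this iterate_product_integrable[OF ij] HK_entry_integrable[OF ij]]
    indep_var_lebesgue_integral[OF this iterate_product_integrable[OF ij] HK_entry_integrable[OF ij]]
  show "integrable M (\<lambda>\<omega>. iterate k \<omega> $ i * iterate k \<omega> $ j * (H * K (R k \<omega>)) $$ (i, j))"
    by (rule indep(1))
  show "expectation (\<lambda>\<omega>. iterate k \<omega> $ i * iterate k \<omega> $ j * (H * K (R k \<omega>)) $$ (i, j)) =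
      expectation (\<lambda>\<omega>. iterate k \<omega> $ i * iterate k \<omega> $ j) * (H * EK) $$ (i, j)"
    unfolding indep(2) expectation_HK[OF ij] ..
qed

lemma expectation_energy_Suc:
  "expectation (\<lambda>\<omega>. scalar_prod (iterate (Suc k) \<omega>) (H *\<^sub>v iterate (Suc k) \<omega>)) =
   expectation (\<lambda>\<omega>. scalar_prod (iterate k \<omega>) (H *\<^sub>v iterate k \<omega>)) -
   expectation (\<lambda>\<omega>. scalar_prod (iterate k \<omega>) ((H * EK) *\<^sub>v iterate k \<omega>))"
proof -
  let ?w = "\<lambda>\<omega>. \<Sum>i<d. \<Sum>j<d. iterate k \<omega> $ i * iterate k \<omega> $ j * (H * K (R k \<omega>)) $$ (i, j)"
  have "scalar_prod (iterate (Suc k) \<omega>) (H *\<^sub>v iterate (Suc k) \<omega>) =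
      scalar_prod (iterate k \<omega>) (H *\<^sub>v iterate k \<omega>) - ?w \<omega>" if \<omega>: "\<omega> \<in> space M" for \<omega>
  proof -
    interpret weighted_projection d H "K (R k \<omega>)" by (rule projection[OF R_space[OF \<omega>]])
    note w = iterate_carrier[OF \<omega>, of k]
    have HK: "H * K (R k \<omega>) \<in> carrier_mat d d" using H_carrier K by simp
    show ?thesis
      using complement_energy[OF w] scalar_prod_mult_mat_vec[OF HK w w] by (simp add: algebra_simps)
  qed
  then have "expectation (\<lambda>\<omega>. scalar_prod (iterate (Suc k) \<omega>) (H *\<^sub>v iterate (Suc k) \<omega>)) =
      expectation (\<lambda>\<omega>. scalar_prod (iterate k \<omega>) (H *\<^sub>v iterate k \<omega>) - ?w \<omega>)"
    by (intro Bochner_Integration.integral_cong) auto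
  also have "\<dots> = expectation (\<lambda>\<omega>. scalar_prod (iterate k \<omega>) (H *\<^sub>v iterate k \<omega>)) - expectation ?w"
    by (intro Bochner_Integration.integral_diff iterate_form_integrable(1) H_carrier
        Bochner_Integration.integrable_sum iterate_indep_K) auto
  also have "expectation ?w = (\<Sum>i<d. \<Sum>j<d. expectation (\<lambda>\<omega>. iterate k \<omega> $ i * iterate k \<omega> $ j) * (H * EK) $$ (i, j))"
    by (subst integral_double_sum) (simp_all add: iterate_indep_K del: index_mult_mat)
  also have "\<dots> = expectation (\<lambda>\<omega>. scalar_prod (iterate k \<omega>) ((H * EK) *\<^sub>v iterate k \<omega>))"
    by (simp add: iterate_form_integrable(2)[OF mult_carrier_mat[OF H_carrier EK_carrier]] mult.commute
        del: index_mult_mat)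
  finally show ?thesis .
qed

text \<open>Tested on a unit vector: the form of each \<open>H * K\<close> is at most that of
  \<open>H\<close>, hence so is the form of the mean, and the Rayleigh bound can be divided by the
  positive energy.\<close>

lemma lambda_min_EK_le_one: "lambda_min EK \<le> 1"
proof -
  define w :: "real Matrix.vec" where "w = unit_vec d 0"
  have w: "w \<in> carrier_vec d" "w \<noteq> 0\<^sub>v d" using d by (auto simp: w_def unit_vec_def zero_vec_def dest!: arg_cong[where f = "\<lambda>v. v $ 0"])
  have HEK: "H * EK \<in> carrier_mat d d" using H_carrier EK_carrier by simp
  let ?f = "\<lambda>\<omega>. \<Sum>i<d. \<Sum>j<d. w $ i * (H * K (R 0 \<omega>)) $$ (i, j) * w $ j"
  have int: "integrable M ?f"
    by (intro Bochner_Integration.integrable_sum integrable_mult_left integrable_mult_right HK_entry_integrable) auto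
  have "scalar_prod w ((H * EK) *\<^sub>v w) = expectation ?f"
    unfolding scalar_prod_mult_mat_vec[OF HEK w(1) w(1)]
    by (subst integral_double_sum) (simp_all add: HK_entry_integrable expectation_HK del: index_mult_mat)
  also have "\<dots> \<le> expectation (\<lambda>_. scalar_prod w (H *\<^sub>v w))"
  proof (rule integral_mono[OF int])
    fix \<omega> assume \<omega>: "\<omega> \<in> space M"
    interpret weighted_projection d H "K (R 0 \<omega>)" by (rule projection[OF R_space[OF \<omega>]])
    have HK: "H * K (R 0 \<omega>) \<in> carrier_mat d d" using H_carrier K by simp
    show "?f \<omega> \<le> scalar_prod w (H *\<^sub>v w)"
      using proj_form_le[OF w(1)] scalar_prod_mult_mat_vec[OF HK w(1) w(1)] by simp
  qed simp
  also have "\<dots> = scalar_prod w (H *\<^sub>v w)" by (simp add: prob_space)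
  finally have "lambda_min EK * scalar_prod w (H *\<^sub>v w) \<le> 1 * scalar_prod w (H *\<^sub>v w)"
    using lambda_min_le_rayleigh[OF d H EK_carrier HEK_sym w(1)] by simp
  moreover have "0 < scalar_prod w (H *\<^sub>v w)" using H w by (simp add: symmetric_pos_def_def)
  ultimately show ?thesis by (simp only: mult_le_cancel_right_pos)
qed

lemma expectation_energy_le:
  "expectation (\<lambda>\<omega>. scalar_prod (iterate k \<omega>) (H *\<^sub>v iterate k \<omega>)) \<le>
    (1 - lambda_min EK) ^ k * scalar_prod v0 (H *\<^sub>v v0)"
proof (induction k)
  case 0
  then show ?case by (simp add: prob_space)
next
  case (Suc k)
  have HEK: "H * EK \<in> carrier_mat d d" using H_carrier EK_carrier by simp
  have "lambda_min EK * expectation (\<lambda>\<omega>. scalar_prod (iterate k \<omega>) (H *\<^sub>v iterate k \<omega>)) =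
      expectation (\<lambda>\<omega>. lambda_min EK * scalar_prod (iterate k \<omega>) (H *\<^sub>v iterate k \<omega>))" by simp
  also have "\<dots> \<le> expectation (\<lambda>\<omega>. scalar_prod (iterate k \<omega>) ((H * EK) *\<^sub>v iterate k \<omega>))"
    by (intro integral_mono integrable_mult_right iterate_form_integrable(1) H_carrier HEK
        lambda_min_le_rayleigh[OF d H EK_carrier HEK_sym] iterate_carrier)
  finally have "expectation (\<lambda>\<omega>. scalar_prod (iterate (Suc k) \<omega>) (H *\<^sub>v iterate (Suc k) \<omega>)) \<le>
      (1 - lambda_min EK) * expectation (\<lambda>\<omega>. scalar_prod (iterate k \<omega>) (H *\<^sub>v iterate k \<omega>))"
    unfolding expectation_energy_Suc by (simp add: algebra_simps)
  \<comment> \<open>Multiplying the induction hypothesis by the factor requires the factor to be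
    nonnegative.\<close>
  also have "\<dots> \<le> (1 - lambda_min EK) * ((1 - lambda_min EK) ^ k * scalar_prod v0 (H *\<^sub>v v0))"
    using Suc lambda_min_EK_le_one by (intro mult_left_mono) auto
  finally show ?case by (simp add: mult.assoc)
qed

end

section \<open>The error of sketch-and-project\<close>

lemma entries_measurable_kronecker:
  fixes E F :: "'a \<Rightarrow> real mat"
  assumes "entries_measurable N r c E" "entries_measurable N r' c' F"
  shows "entries_measurable N (r * r') (c * c') (\<lambda>x. kronecker (E x) (F x))"
  unfolding entries_measurable_def
proof (intro conjI ballI allI impI)
  fix x assume "x \<in> space N"
  then have "E x \<in> carrier_mat r c" "F x \<in> carrier_mat r' c'" using assms by (auto simp: entries_measurable_def)
  then show "kronecker (E x) (F x) \<in> carrier_mat (r * r') (c * c')" by (intro carrier_matI) auto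
next
  fix i j assume ij: "i < r * r'" "j < c * c'"
  have "(\<lambda>x. E x $$ (i div r', j div c') * F x $$ (i mod r', j mod c')) \<in> borel_measurable N"
    using assms less_mult_div_mod[OF ij(1)] less_mult_div_mod[OF ij(2)]
    by (intro borel_measurable_times) (auto simp: entries_measurable_def)
  also have "?this \<longleftrightarrow> (\<lambda>x. kronecker (E x) (F x) $$ (i, j)) \<in> borel_measurable N"
  proof (rule measurable_cong)
    fix x assume "x \<in> space N"
    then have "E x \<in> carrier_mat r c" "F x \<in> carrier_mat r' c'" using assms by (auto simp: entries_measurable_def)
    then show "E x $$ (i div r', j div c') * F x $$ (i mod r', j mod c') = kronecker (E x) (F x) $$ (i, j)"
      using ij by (simp add: kronecker_def)
  qed
  finally show "(\<lambda>x. kronecker (E x) (F x) $$ (i, j)) \<in> borel_measurable N" .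
qed

lemma entries_measurable_compose:
  assumes "g \<in> measurable N N'" "entries_measurable N' r c F"
  shows "entries_measurable N r c (\<lambda>x. F (g x))"
  using assms measurable_space[OF assms(1)] unfolding entries_measurable_def
  by (auto intro: measurable_compose[OF assms(1)])

lemma Z2_projection:
  assumes B: "B \<in> carrier_mat n q" and P: "P \<in> carrier_mat q c"
  shows "Z2 B P \<in> carrier_mat n n" "Z2 B P * Z2 B P = Z2 B P" "transpose_mat (Z2 B P) = Z2 B P"
proof -
  have Bt: "transpose_mat B \<in> carrier_mat q n" using B by simp
  note Z = Z1'_projection[OF symmetric_pos_def_one Bt P, folded Z2_eq_Z1'[OF B P]]
  show "Z2 B P \<in> carrier_mat n n" "Z2 B P * Z2 B P = Z2 B P" by (rule Z)+
  show "transpose_mat (Z2 B P) = Z2 B P" using Z(3) left_mult_one_mat[OF Z(1)] by simp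
qed

text \<open>With \<open>C\<close> written as \<open>A * Xs * B\<close> the residual becomes
  \<open>A * (X - Xs) * B\<close>; what remains is regrouping the factors on either side into
  \<open>Z1'\<close> and \<open>Z2\<close>.\<close>

lemma sketch_project_step_error:
  assumes G: "symmetric_pos_def m G" and A: "A \<in> carrier_mat p m" and B: "B \<in> carrier_mat n q"
    and S: "S \<in> carrier_mat p c" and P: "P \<in> carrier_mat q e"
    and X: "X \<in> carrier_mat m n" and Xs: "Xs \<in> carrier_mat m n"
  shows "sketch_project_step G A B (A * Xs * B) S P X - Xs = (X - Xs) - Z1' G A S * (X - Xs) * Z2 B P"
proof -
  define V where "V = pinv (transpose_mat S * A * inv_mat G * transpose_mat A * S)"
  define W where "W = pinv (transpose_mat P * transpose_mat B * B * P)"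
  have V: "V \<in> carrier_mat c c"
    using pinv_symmetric(1)[OF sketch_gram_symmetric[OF G A S]] sketch_gram_symmetric(1)[OF G A S] S
    by (simp add: V_def penrose_def)
  have gram: "transpose_mat P * transpose_mat B * B * P \<in> carrier_mat e e"
    "transpose_mat (transpose_mat P * transpose_mat B * B * P) = transpose_mat P * transpose_mat B * B * P"
    using B P by (auto simp: mult_mat_assoc_dim transpose_mult_dim intro!: carrier_matI)
  have W: "W \<in> carrier_mat e e"
    using pinv_symmetric(1)[OF gram] gram(1) P by (simp add: W_def penrose_def)
  note I = inv_mat_symmetric_pos_def(1)[OF G]
  have [simp]: "dim_row A = p" "dim_col A = m" "dim_row B = n" "dim_col B = q" "dim_row S = p" "dim_col S = c"
    "dim_row P = q" "dim_col P = e" "dim_row V = c" "dim_col V = c" "dim_row W = e" "dim_col W = e"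
    "dim_row (inv_mat G) = m" "dim_col (inv_mat G) = m" "dim_row X = m" "dim_col X = n"
    "dim_row Xs = m" "dim_col Xs = n"
    using A B S P V W I X Xs by auto
  have "A * X * B - A * Xs * B = A * (X - Xs) * B"
    using A B X Xs
    by (simp add: mult_minus_distrib_mat[OF A X Xs]
        minus_mult_distrib_mat[of "A * X" p n "A * Xs" B q])
  then have "sketch_project_step G A B (A * Xs * B) S P X =
      X - inv_mat G * transpose_mat A * S * V * transpose_mat S * (A * (X - Xs) * B) * P * W * transpose_mat P * transpose_mat B"
    by (simp add: sketch_project_step_def V_def W_def)
  also have "\<dots> = X - Z1' G A S * (X - Xs) * Z2 B P"
    unfolding Z1'_def Z2_def V_def[symmetric] W_def[symmetric] by (simp add: mult_mat_assoc_dim)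
  finally have *: "sketch_project_step G A B (A * Xs * B) S P X = X - Z1' G A S * (X - Xs) * Z2 B P" .
  have "Z1' G A S * (X - Xs) * Z2 B P \<in> carrier_mat m n"
    using Z1'_projection(1)[OF G A S] Z2_projection(1)[OF B P] by (intro carrier_matI) auto
  moreover have "X - Q - Xs = (X - Xs) - Q" if "Q \<in> carrier_mat m n" for Q
    using X Xs that by (intro eq_matI) auto
  ultimately show ?thesis unfolding * by blast
qed

lemma weighted_projection_kronecker:
  assumes G: "symmetric_pos_def m G" and A: "A \<in> carrier_mat p m" and B: "B \<in> carrier_mat n q"
    and S: "S \<in> carrier_mat p c" and P: "P \<in> carrier_mat q e"
  shows "weighted_projection (n * m) (kronecker (1\<^sub>m n) G) (kronecker (Z2 B P) (Z1' G A S))"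
proof
  note Z1 = Z1'_projection[OF G A S] and Z2 = Z2_projection[OF B P]
  have Gc: "G \<in> carrier_mat m m" using G by (simp add: symmetric_pos_def_def)
  show "symmetric_pos_def (n * m) (kronecker (1\<^sub>m n) G)" by (rule symmetric_pos_def_kronecker[OF G])
  show "kronecker (Z2 B P) (Z1' G A S) \<in> carrier_mat (n * m) (n * m)"
    using Z1(1) Z2(1) by (intro carrier_matI) auto
  show "kronecker (Z2 B P) (Z1' G A S) * kronecker (Z2 B P) (Z1' G A S) = kronecker (Z2 B P) (Z1' G A S)"
    using Z1 Z2 by (simp add: kronecker_mult)
  have "kronecker (1\<^sub>m n) G * kronecker (Z2 B P) (Z1' G A S) = kronecker (Z2 B P) (G * Z1' G A S)"
    using Z1(1) Z2(1) Gc by (simp add: kronecker_mult)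
  then show "transpose_mat (kronecker (1\<^sub>m n) G * kronecker (Z2 B P) (Z1' G A S)) =
      kronecker (1\<^sub>m n) G * kronecker (Z2 B P) (Z1' G A S)"
    by (simp add: transpose_kronecker Z1(3) Z2(3))
qed

text \<open>The carrier statement is proved jointly because the one-step error formula needs the
  shape of the current iterate. The column counts of the sketches are unrestricted and may change
  from step to step.\<close>

lemma sketch_project_stack:
  assumes G: "symmetric_pos_def m G" and A: "A \<in> carrier_mat p m" and B: "B \<in> carrier_mat n q"
    and X0: "X0 \<in> carrier_mat m n" and Xs: "Xs \<in> carrier_mat m n"
    and SP: "\<And>i. dim_row (S i) = p" "\<And>i. dim_row (P i) = q"
  shows "sketch_project G A B (A * Xs * B) X0 S P k \<in> carrier_mat m n \<and>
    stack (sketch_project G A B (A * Xs * B) X0 S P k - Xs) =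
    proj_iter (\<lambda>(S, P). kronecker (Z2 B P) (Z1' G A S)) (stack (X0 - Xs)) (\<lambda>i. (S i, P i)) k"
proof (induction k)
  case 0
  then show ?case using X0 by simp
next
  case (Suc k)
  define X where "X = sketch_project G A B (A * Xs * B) X0 S P k"
  have X: "X \<in> carrier_mat m n" using Suc by (simp add: X_def)
  have Sc: "S k \<in> carrier_mat p (dim_col (S k))" and Pc: "P k \<in> carrier_mat q (dim_col (P k))"
    using SP by (auto intro: carrier_matI)
  note Z1 = Z1'_projection(1)[OF G A Sc] and Z2 = Z2_projection(1,3)[OF B Pc]
  have "stack (sketch_project_step G A B (A * Xs * B) (S k) (P k) X - Xs) =
      stack (X - Xs) - stack (Z1' G A (S k) * (X - Xs) * Z2 B (P k))"
    unfolding sketch_project_step_error[OF G A B Sc Pc X Xs]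
    using X Xs Z1 Z2 by (intro stack_minus) auto
  also have "\<dots> = stack (X - Xs) - kronecker (Z2 B (P k)) (Z1' G A (S k)) *\<^sub>v stack (X - Xs)"
    using X Xs Z1 Z2 by (simp add: kronecker_mult_stack)
  finally have "stack (sketch_project_step G A B (A * Xs * B) (S k) (P k) X - Xs) =
      stack (X - Xs) - kronecker (Z2 B (P k)) (Z1' G A (S k)) *\<^sub>v stack (X - Xs)" .
  moreover have "sketch_project_step G A B (A * Xs * B) (S k) (P k) X \<in> carrier_mat m n"
    using B inv_mat_symmetric_pos_def(1)[OF G] by (intro carrier_matI) (auto simp: sketch_project_step_def)
  ultimately show ?case
    using Suc by (simp add: X_def[symmetric])
qed

theorem theorem4p1:
  fixes p m n q :: nat
    and A B C G X0 :: "real mat"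
    and M :: "'w measure"
    and D :: "(real mat \<times> real mat) measure"
    and S P :: "nat \<Rightarrow> 'w \<Rightarrow> real mat"
    and X :: "nat \<Rightarrow> 'w \<Rightarrow> real mat"
    and \<rho> :: real
  assumes "0 < m" and "0 < n"
    and "A \<in> carrier_mat p m" and "B \<in> carrier_mat n q" and "C \<in> carrier_mat p q"
    and consistent: "\<exists>Y \<in> carrier_mat m n. A * Y * B = C"
    and "symmetric_pos_def m G"
    and "X0 \<in> carrier_mat m n"
    and "prob_space M"
    and independent: "prob_space.indep_vars M (\<lambda>_. mat_algebra p \<Otimes>\<^sub>M mat_algebra q)
           (\<lambda>k \<omega>. (S k \<omega>, P k \<omega>)) UNIV"
    and identically_distributed:
      "\<And>k. distr M (mat_algebra p \<Otimes>\<^sub>M mat_algebra q) (\<lambda>\<omega>. (S k \<omega>, P k \<omega>)) = D"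
    and X: "\<And>k \<omega>. X k \<omega> = sketch_project G A B C X0 (\<lambda>i. S i \<omega>) (\<lambda>i. P i \<omega>) k"
    and rho: "\<rho> = 1 - lambda_min (mat_expectation (n * m) (n * m) D
                 (\<lambda>(S, P). kronecker (Z2 B P) (Z1' G A S)))"
  shows "\<forall>Xs \<in> carrier_mat m n. A * Xs * B = C \<longrightarrow>
     (\<forall>k. integrable M (\<lambda>\<omega>. frob_norm_sq G (X k \<omega> - Xs)) \<and>
          (\<integral>\<omega>. frob_norm_sq G (X k \<omega> - Xs) \<partial>M) \<le> \<rho> ^ k * frob_norm_sq G (X0 - Xs)) \<and>
     (0 \<le> \<rho> \<and> \<rho> < 1 \<longrightarrow>
        (\<lambda>k. \<integral>\<omega>. frob_norm_sq G (X k \<omega> - Xs) \<partial>M) \<longlonglongrightarrow> 0)"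
proof (intro ballI impI)
  fix Xs assume Xs: "Xs \<in> carrier_mat m n" and sol: "A * Xs * B = C"
  interpret prob_space M by fact
  note A = \<open>A \<in> carrier_mat p m\<close> and B = \<open>B \<in> carrier_mat n q\<close> and G = \<open>symmetric_pos_def m G\<close>
    and X0 = \<open>X0 \<in> carrier_mat m n\<close>
  let ?N = "mat_algebra p \<Otimes>\<^sub>M mat_algebra q"
  let ?K = "\<lambda>(S, P). kronecker (Z2 B P) (Z1' G A S)"
  let ?H = "kronecker (1\<^sub>m n) G"
  have carriers: "fst x \<in> carrier_mat p (dim_col (fst x))" "snd x \<in> carrier_mat q (dim_col (snd x))"
    if "x \<in> space ?N" for x
    using that by (auto simp: space_pair_measure space_mat_algebra intro!: carrier_matI)
  have proj: "weighted_projection (n * m) ?H (?K x)" if "x \<in> space ?N" for x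
    using weighted_projection_kronecker[OF G A B carriers[OF that]] by (simp add: case_prod_beta)
  interpret iid_projections M ?N D ?K "\<lambda>k \<omega>. (S k \<omega>, P k \<omega>)" "n * m" ?H "stack (X0 - Xs)"
  proof unfold_locales
    show "0 < n * m" using \<open>0 < m\<close> \<open>0 < n\<close> by simp
    show "symmetric_pos_def (n * m) ?H" by (rule symmetric_pos_def_kronecker[OF G])
    show "stack (X0 - Xs) \<in> carrier_vec (n * m)" using X0 Xs by (intro carrier_vecI) simp
    show "entries_measurable ?N (n * m) (n * m) ?K"
      unfolding case_prod_beta
      by (intro entries_measurable_kronecker entries_measurable_compose[OF measurable_fst Z1'_measurable[OF G A]]
          entries_measurable_compose[OF measurable_snd Z2_measurable[OF B]])
    show "?K x * ?K x = ?K x" if "x \<in> space ?N" for x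
      using weighted_projection.idem[OF proj[OF that]] .
    show "transpose_mat (?H * ?K x) = ?H * ?K x" if "x \<in> space ?N" for x
      using weighted_projection.sym[OF proj[OF that]] .
  qed (fact independent identically_distributed)+
  let ?err = "\<lambda>k \<omega>. proj_iter ?K (stack (X0 - Xs)) (\<lambda>i. (S i \<omega>, P i \<omega>)) k"
  have Gc: "G \<in> carrier_mat m m" using G by (simp add: symmetric_pos_def_def)
  \<comment> \<open>Restricted to points of the space because the row counts of the sketches are
    known only there, from measurability of the samples.\<close>
  have norm: "frob_norm_sq G (X k \<omega> - Xs) = scalar_prod (?err k \<omega>) (?H *\<^sub>v ?err k \<omega>)"
    if "\<omega> \<in> space M" for k \<omega>
  proof -
    have "dim_row (S i \<omega>) = p" "dim_row (P i \<omega>) = q" for i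
      using R_space[OF that, of i] by (auto simp: space_pair_measure space_mat_algebra)
    from sketch_project_stack[where S = "\<lambda>i. S i \<omega>" and P = "\<lambda>i. P i \<omega>" and k = k, OF G A B X0 Xs this]
    have Xk: "X k \<omega> \<in> carrier_mat m n" "stack (X k \<omega> - Xs) = ?err k \<omega>" by (simp_all add: sol X)
    show ?thesis
      unfolding Xk(2)[symmetric] using Xs by (intro frob_norm_sq_stack[OF Gc] minus_carrier_mat)
  qed
  have norm0: "frob_norm_sq G (X0 - Xs) = scalar_prod (stack (X0 - Xs)) (?H *\<^sub>v stack (X0 - Xs))"
    using X0 Xs by (intro frob_norm_sq_stack[OF Gc]) auto
  have Hc: "?H \<in> carrier_mat (n * m) (n * m)" using Gc by (intro carrier_matI) auto
  have int: "integrable M (\<lambda>\<omega>. frob_norm_sq G (X k \<omega> - Xs))" for k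
    using iterate_form_integrable(1)[OF Hc] by (subst Bochner_Integration.integrable_cong[OF refl norm])
  have le: "(\<integral>\<omega>. frob_norm_sq G (X k \<omega> - Xs) \<partial>M) \<le> \<rho> ^ k * frob_norm_sq G (X0 - Xs)" for k
    using expectation_energy_le[of k] unfolding norm0 rho
    by (subst Bochner_Integration.integral_cong[OF refl norm])
  have nonneg: "0 \<le> (\<integral>\<omega>. frob_norm_sq G (X k \<omega> - Xs) \<partial>M)" for k
    using symmetric_pos_def_nonneg[OF H iterate_carrier] norm
    by (intro Bochner_Integration.integral_nonneg_AE AE_I2) simp
  have "(\<lambda>k. \<integral>\<omega>. frob_norm_sq G (X k \<omega> - Xs) \<partial>M) \<longlonglongrightarrow> 0" if "0 \<le> \<rho> \<and> \<rho> < 1"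
  proof (rule tendsto_sandwich[OF _ _ tendsto_const])
    show "(\<lambda>k. \<rho> ^ k * frob_norm_sq G (X0 - Xs)) \<longlonglongrightarrow> 0"
      using that by (intro tendsto_mult_left_zero LIMSEQ_realpow_zero) auto
  qed (use le nonneg in auto)
  then show "(\<forall>k. integrable M (\<lambda>\<omega>. frob_norm_sq G (X k \<omega> - Xs)) \<and>
          (\<integral>\<omega>. frob_norm_sq G (X k \<omega> - Xs) \<partial>M) \<le> \<rho> ^ k * frob_norm_sq G (X0 - Xs)) \<and>
     (0 \<le> \<rho> \<and> \<rho> < 1 \<longrightarrow>
        (\<lambda>k. \<integral>\<omega>. frob_norm_sq G (X k \<omega> - Xs) \<partial>M) \<longlonglongrightarrow> 0)"
    using int le by blast
qed

end
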